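(* Let $d\ge 1$, $\varepsilon>0$, $u_0\in\mathcal{M}_\varepsilon(\mathbb{R}^d)$, set $T(\varepsilon)=\frac{1}{4\varepsilon}$, and let $$u(x,t)=\frac{1}{(4\pi t)^{d/2}}\int_{\mathbb{R}^d}e^{-|x-y|^2/4t}\,\mathrm{d}u_0(y).$$ Then: (i) $u(t)\in L^\infty_{\rm loc}(\mathbb{R}^d)$ for every $t\in(0,T(\varepsilon))$. Moreover $u\in C^\infty(\mathbb{R}^d\times(0,T(\varepsilon)))$ and $u_t-\Delta u=0$ for all $x\in\mathbb{R}^d$, $0<t<T(\varepsilon)$. (ii) For every $\varphi\in C_c(\mathbb{R}^d)$ and $0\le t<T(\varepsilon)$, $$\int_{\mathbb{R}^d}\varphi\,u(t)=\int_{\mathbb{R}^d}S(t)\varphi\,\mathrm{d}u_0 .$$ In particular $u(t)\to u_0$ as $t\to0^+$ in the sense of measures, i.e. $\int_{\mathbb{R}^d}\varphi\,u(t)\to\int_{\mathbb{R}^d}\varphi\,\mathrm{d}u_0$ for every $\varphi\in C_c(\mathbb{R}^d)$. (iii) If in addition $u_0\ge0$ is non-zero, then $u(x,t)>0$ for all $x\in\mathbb{R}^d$ and $t\in(0,T(\varepsilon))$.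
   Context: $\mathcal{M}_{\rm loc}(\mathbb{R}^d)$ is the set of (signed) Radon measures on $\mathbb{R}^d$, identified with the dual of $C_c(\mathbb{R}^d)$ (linear functionals $L$ such that for each compact $K$ there is $C_K$ with $|L(\varphi)|\le C_K\sup_K|\varphi|$ whenever $\mathrm{supp}\,\varphi\subset K$). Each $\mu$ has a unique Jordan decomposition $\mu=\mu^+-\mu^-$ into mutually singular non-negative Radon measures, and $|\mu|=\mu^++\mu^-$. For $\varepsilon>0$, $\mathcal{M}_\varepsilon(\mathbb{R}^d)=\{\mu\in\mathcal{M}_{\rm loc}(\mathbb{R}^d):\int_{\mathbb{R}^d}e^{-\varepsilon|x|^2}\,\mathrm{d}|\mu|(x)<\infty\}$. For $\varphi\in C_c(\mathbb{R}^d)$, $S(t)\varphi(x)=(4\pi t)^{-d/2}\int_{\mathbb{R}^d}e^{-|x-y|^2/4t}\varphi(y)\,\mathrm{d}y$ for $t>0$ and $S(0)\varphi=\varphi$. Write $u(t)=u(\cdot,t)$; $\int\varphi\,u(t)$ means $\int\varphi(x)u(x,t)\,\mathrm{d}x$ for $t>0$ and $\int\varphi\,\mathrm{d}u_0$ for $t=0$. *)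

theory Defs
  imports "HOL-Analysis.Analysis"
begin

definition Cc :: "('a::euclidean_space \<Rightarrow> real) set" where
  "Cc = {\<phi>. continuous_on UNIV \<phi> \<and> compact (closure {x. \<phi> x \<noteq> 0})}"

text \<open>
  A signed Radon measure is the linear functional \<open>\<phi> \<mapsto> \<integral>\<phi> d\<mu>\<close> it induces on \<^const>\<open>Cc\<close>.
  Functionals are total HOL functions; their values outside \<^const>\<open>Cc\<close> are irrelevant
  and nothing below depends on them.
\<close>

type_synonym 'a radon = "('a \<Rightarrow> real) \<Rightarrow> real"

definition M_loc :: "('a::euclidean_space) radon set" where
  "M_loc = {\<mu>.
     (\<forall>\<phi>\<in>Cc. \<forall>\<psi>\<in>Cc. \<mu> (\<lambda>x. \<phi> x + \<psi> x) = \<mu> \<phi> + \<mu> \<psi>) \<and>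
     (\<forall>c. \<forall>\<phi>\<in>Cc. \<mu> (\<lambda>x. c * \<phi> x) = c * \<mu> \<phi>) \<and>
     (\<forall>K. compact K \<longrightarrow>
        (\<exists>C. \<forall>\<phi>\<in>Cc. closure {x. \<phi> x \<noteq> 0} \<subseteq> K \<longrightarrow> \<bar>\<mu> \<phi>\<bar> \<le> C * (SUP x\<in>K. \<bar>\<phi> x\<bar>)))}"

text \<open>
  Non-negative Radon measures; on a Euclidean space a Borel measure that is finite on
  compact sets is automatically regular.
\<close>

definition radon_measure :: "('a::euclidean_space) measure \<Rightarrow> bool" where
  "radon_measure M \<longleftrightarrow> sets M = sets borel \<and> (\<forall>K. compact K \<longrightarrow> emeasure M K < \<infinity>)"

definition mutually_singular :: "('a::euclidean_space) measure \<Rightarrow> 'a measure \<Rightarrow> bool" where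
  "mutually_singular P N \<longleftrightarrow> (\<exists>A\<in>sets borel. emeasure P A = 0 \<and> emeasure N (- A) = 0)"

definition jordan_decomposition ::
    "('a::euclidean_space) radon \<Rightarrow> 'a measure \<Rightarrow> 'a measure \<Rightarrow> bool" where
  "jordan_decomposition \<mu> P N \<longleftrightarrow>
     radon_measure P \<and> radon_measure N \<and> mutually_singular P N \<and>
     (\<forall>\<phi>\<in>Cc. \<mu> \<phi> = integral\<^sup>L P \<phi> - integral\<^sup>L N \<phi>)"

text \<open>The measure \<open>P + N\<close>, i.e. \<open>|\<mu>|\<close> when \<open>P\<close>, \<open>N\<close> is the Jordan decomposition of \<open>\<mu>\<close>.\<close>

definition measure_plus :: "('a::euclidean_space) measure \<Rightarrow> 'a measure \<Rightarrow> 'a measure" where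
  "measure_plus P N = measure_of UNIV (sets borel) (\<lambda>A. emeasure P A + emeasure N A)"

text \<open>
  Every element of \<^const>\<open>M_loc\<close> has exactly one Jordan decomposition, so the
  existential quantifier merely names it.
\<close>

definition M_eps :: "real \<Rightarrow> ('a::euclidean_space) radon set" where
  "M_eps \<epsilon> = {\<mu>\<in>M_loc. \<exists>P N. jordan_decomposition \<mu> P N \<and>
     (\<integral>\<^sup>+x. ennreal (exp (- \<epsilon> * (norm x)\<^sup>2)) \<partial>measure_plus P N) < \<infinity>}"

definition jordan_parts :: "('a::euclidean_space) radon \<Rightarrow> 'a measure \<times> 'a measure" where
  "jordan_parts \<mu> = (THE PN. jordan_decomposition \<mu> (fst PN) (snd PN))"

definition radon_integrable :: "('a::euclidean_space) radon \<Rightarrow> ('a \<Rightarrow> real) \<Rightarrow> bool" where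
  "radon_integrable \<mu> f \<longleftrightarrow>
     integrable (fst (jordan_parts \<mu>)) f \<and> integrable (snd (jordan_parts \<mu>)) f"

definition radon_integral :: "('a::euclidean_space) radon \<Rightarrow> ('a \<Rightarrow> real) \<Rightarrow> real" where
  "radon_integral \<mu> f =
     integral\<^sup>L (fst (jordan_parts \<mu>)) f - integral\<^sup>L (snd (jordan_parts \<mu>)) f"

definition radon_nonneg :: "('a::euclidean_space) radon \<Rightarrow> bool" where
  "radon_nonneg \<mu> \<longleftrightarrow> (\<forall>\<phi>\<in>Cc. (\<forall>x. 0 \<le> \<phi> x) \<longrightarrow> 0 \<le> \<mu> \<phi>)"

definition radon_nonzero :: "('a::euclidean_space) radon \<Rightarrow> bool" where
  "radon_nonzero \<mu> \<longleftrightarrow> (\<exists>\<phi>\<in>Cc. \<mu> \<phi> \<noteq> 0)"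

definition heat_solution :: "('a::euclidean_space) radon \<Rightarrow> 'a \<Rightarrow> real \<Rightarrow> real" where
  "heat_solution u0 x t =
     1 / (4 * pi * t) powr (real DIM('a) / 2)
       * radon_integral u0 (\<lambda>y. exp (- (norm (x - y))\<^sup>2 / (4 * t)))"

definition heat_semigroup :: "real \<Rightarrow> ('a::euclidean_space \<Rightarrow> real) \<Rightarrow> 'a \<Rightarrow> real" where
  "heat_semigroup t \<phi> x =
     (if t = 0 then \<phi> x
      else 1 / (4 * pi * t) powr (real DIM('a) / 2)
             * (\<integral>y. exp (- (norm (x - y))\<^sup>2 / (4 * t)) * \<phi> y \<partial>lborel))"

definition Linf_loc :: "('a::euclidean_space \<Rightarrow> real) \<Rightarrow> bool" where
  "Linf_loc f \<longleftrightarrow> f \<in> borel_measurable lebesgue \<and>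
     (\<forall>K. compact K \<longrightarrow> (\<exists>C. AE x in lebesgue. x \<in> K \<longrightarrow> \<bar>f x\<bar> \<le> C))"

text \<open>
  \<open>C\<^sup>k\<close> regularity on an open set: \<open>f\<close> is differentiable there and all its
  directional derivatives are \<open>C\<^sup>k\<^sup>-\<^sup>1\<close>.
\<close>

primrec Ck_on :: "nat \<Rightarrow> ('a::real_normed_vector \<Rightarrow> real) \<Rightarrow> 'a set \<Rightarrow> bool" where
  "Ck_on 0 f S \<longleftrightarrow> continuous_on S f"
| "Ck_on (Suc k) f S \<longleftrightarrow>
     (\<forall>x\<in>S. f differentiable (at x)) \<and>
     (\<forall>v. Ck_on k (\<lambda>x. frechet_derivative f (at x) v) S)"

definition Cinf_on :: "('a::real_normed_vector \<Rightarrow> real) \<Rightarrow> 'a set \<Rightarrow> bool" where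
  "Cinf_on f S \<longleftrightarrow> (\<forall>k. Ck_on k f S)"

definition laplacian :: "('a::euclidean_space \<Rightarrow> real) \<Rightarrow> 'a \<Rightarrow> real" where
  "laplacian f x = (\<Sum>b\<in>Basis. deriv (deriv (\<lambda>s. f (x + s *\<^sub>R b))) 0)"

end

theory Submission
  imports Defs "HOL-Probability.Distributions"
begin

text \<open>
  A signed measure \<open>\<mu>\<close> is written as \<open>h |\<mu>|\<close> with \<open>|h| = 1\<close> (\<open>M_eps_polar\<close>), so that only one
  non-negative measure \<open>M = |\<mu>|\<close> with \<open>\<integral> exp (- \<epsilon>|y|\<^sup>2) dM < \<infinity>\<close> has to be studied. This needs the
  uniqueness of the Jordan decomposition, since the two parts of \<open>\<mu>\<close> are defined by a definite description;
  it holds because a Radon measure is determined by its values on compact sets, and hence by its integrals of test functions.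

  Everything quantitative rests on one completed square (\<open>gaussian_shift_bound\<close>): for \<open>s > \<epsilon>\<close> the function
  \<open>exp (- s|x - y|\<^sup>2)\<close> of \<open>y\<close> is dominated by \<open>exp (- \<epsilon>|y|\<^sup>2)\<close>, locally uniformly in \<open>x\<close>. With \<open>s = 1/4t\<close> the
  condition \<open>s > \<epsilon>\<close> says exactly \<open>t < 1/4\<epsilon>\<close>.

  For smoothness, expand \<open>|x - y|\<^sup>2\<close>: up to the elementary factor \<open>(4\<pi>t)\<^bsup>-d/2\<^esup> exp (- |x|\<^sup>2/4t)\<close>, the solution is
  the Laplace transform \<open>F(z) = \<integral> h(y) exp (z \<bullet> g(y)) dM(y)\<close>, \<open>g(y) = (y, -|y|\<^sup>2)\<close>, evaluated at
  \<open>z = (x/2t, 1/4t)\<close>. The parameter enters the exponent linearly, so differentiating a transform in direction \<open>v\<close> only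
  multiplies its weight by \<open>v \<bullet> g\<close>, and on an open domain of convergence such a factor costs nothing
  (\<open>laplace_Ck_on\<close>). The chain rule for \<open>C\<^sup>k\<close> functions (\<open>Ck_on_compose\<close>) transports the smoothness to \<open>(x, t)\<close>, and the heat
  equation becomes an identity between three kinds of transforms (\<open>potential_heat_equation\<close>).

  The duality with the heat semigroup is Fubini's theorem (\<open>potential_duality\<close>). Given this, convergence to the initial datum is
  dominated convergence for \<open>S(t)\<phi> \<longrightarrow> \<phi>\<close>: \<open>heat_semigroup_gaussian_bound\<close> bounds \<open>S(t)\<phi>\<close> by a multiple of \<open>exp (- \<epsilon>|y|\<^sup>2)\<close>
  uniformly for small \<open>t\<close>. Positivity holds since a non-negative functional has vanishing negative part
  (\<open>radon_nonneg_null_negative_part\<close>), and a positive function has positive integral against a non-zero measure.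
\<close>

section \<open>Radon measures and the Jordan decomposition\<close>

lemma emeasure_measure_plus:
  assumes P: "sets P = sets borel" and N: "sets N = sets borel" and A: "A \<in> sets borel"
  shows "emeasure (measure_plus P N) A = emeasure P A + emeasure N A"
proof (rule emeasure_measure_of[OF measure_plus_def])
  show "countably_additive (sets (measure_plus P N)) (\<lambda>A. emeasure P A + emeasure N A)"
  proof (rule countably_additiveI)
    fix F :: "nat \<Rightarrow> 'a set"
    assume F: "range F \<subseteq> sets (measure_plus P N)" "disjoint_family F"
    have "range F \<subseteq> sets borel"
      using F(1) by (simp add: measure_plus_def sets.sigma_sets_eq[of borel, simplified])
    then show "(\<Sum>i. emeasure P (F i) + emeasure N (F i)) = emeasure P (\<Union> (range F)) + emeasure N (\<Union> (range F))"
      using F(2) P N by (simp add: suminf_add[symmetric] suminf_emeasure)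
  qed
qed (use A in \<open>auto simp: positive_def measure_plus_def sets.sigma_sets_eq[of borel, simplified]\<close>)

lemma sets_measure_plus: "sets (measure_plus P N) = sets borel"
  by (simp add: measure_plus_def sets.sigma_sets_eq[of borel, simplified])

lemma radon_measure_plus:
  assumes "radon_measure P" "radon_measure N"
  shows "radon_measure (measure_plus P N)"
  using assms unfolding radon_measure_def
  by (auto simp: sets_measure_plus emeasure_measure_plus borel_compact)

lemma radon_measure_sigma_finite:
  fixes M :: "'a::euclidean_space measure"
  assumes M: "radon_measure M"
  shows "sigma_finite_measure M"
proof
  have s: "sets M = sets borel" and sp: "space M = UNIV"
    using M sets_eq_imp_space_eq[of M borel] by (auto simp: radon_measure_def)
  have "(\<Union>n. cball (0::'a) (real n)) = UNIV"
    using real_arch_simple by (auto simp: dist_norm) 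
  then show "\<exists>A. countable A \<and> A \<subseteq> sets M \<and> \<Union> A = space M \<and> (\<forall>a\<in>A. emeasure M a \<noteq> \<infinity>)"
    using M by (intro exI[of _ "range (\<lambda>n. cball (0::'a) (real n))"])
      (auto simp: s sp radon_measure_def less_top)
qed

lemma Cc_bounded_support:
  assumes "\<phi> \<in> Cc"
  obtains R B where "0 \<le> R" "0 \<le> B" "\<And>x. \<bar>\<phi> x\<bar> \<le> B * indicator (cball 0 R) x"
proof -
  let ?K = "closure {x. \<phi> x \<noteq> 0}"
  have K: "compact ?K" and c: "continuous_on ?K \<phi>"
    using assms unfolding Cc_def by (auto intro: continuous_on_subset)
  obtain R where R: "0 < R" "?K \<subseteq> cball 0 R"
    using compact_imp_bounded[OF K] bounded_subset_ballD[of ?K 0] by (metis ball_subset_cball order_trans)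
  obtain B where B: "0 < B" "\<forall>x\<in>?K. \<bar>\<phi> x\<bar> \<le> B"
    using compact_imp_bounded[OF compact_continuous_image[OF c K]] by (auto simp: bounded_pos)
  have "\<bar>\<phi> x\<bar> \<le> B * indicator (cball 0 R) x" for x
    using R B closure_subset[of "{x. \<phi> x \<noteq> 0}"] by (cases "\<phi> x = 0") (auto simp: indicator_def)
  with R B show ?thesis by (intro that[of R B]) auto
qed

lemma Cc_borel_measurable: "\<phi> \<in> Cc \<Longrightarrow> \<phi> \<in> borel_measurable borel"
  by (simp add: Cc_def borel_measurable_continuous_onI)

lemma Cc_integrable:
  fixes M :: "'a::euclidean_space measure"
  assumes M: "radon_measure M" and \<phi>: "\<phi> \<in> Cc"
  shows "integrable M \<phi>"
proof -
  obtain R B where RB: "0 \<le> R" "0 \<le> B" "\<And>x. \<bar>\<phi> x\<bar> \<le> B * indicator (cball 0 R) x"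
    using Cc_bounded_support[OF \<phi>] by blast
  have s: "sets M = sets borel" and f: "emeasure M (cball 0 R) < \<infinity>"
    using M by (auto simp: radon_measure_def)
  have m: "\<phi> \<in> borel_measurable M"
    using Cc_borel_measurable[OF \<phi>] measurable_cong_sets[OF s refl] by blast
  have i: "integrable M (\<lambda>x. B * indicator (cball 0 R) x)"
    using f s by (intro integrable_mult_right integrable_real_indicator) auto
  show ?thesis
    by (rule Bochner_Integration.integrable_bound[OF i m])
      (auto intro!: AE_I2 order_trans[OF RB(3) abs_ge_self])
qed

text \<open>
  The tent functions \<open>max 0 (1 - (n + 1) dist(x, K))\<close> decrease to the indicator of \<open>K\<close> and are all dominated by
  the first one. One sequence serves all Radon measures, so identities between integrals of test functions
  pass to compact sets.
\<close>

lemma Cc_approx_indicator: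
  fixes K :: "'a::euclidean_space set"
  assumes K: "compact K"
  obtains \<phi> :: "nat \<Rightarrow> 'a \<Rightarrow> real"
    where "\<And>n. \<phi> n \<in> Cc" "\<And>n x. 0 \<le> \<phi> n x"
      "\<And>M. radon_measure M \<Longrightarrow> (\<lambda>n. integral\<^sup>L M (\<phi> n)) \<longlonglongrightarrow> measure M K"
proof (cases "K = {}")
  case True
  then show ?thesis by (intro that[of "\<lambda>n x. 0"]) (auto simp: Cc_def)
next
  case ne: False
  define \<phi> where "\<phi> n x = max 0 (1 - real (Suc n) * infdist x K)" for n x
  have supp: "{x. \<phi> n x \<noteq> 0} \<subseteq> {x. infdist x K \<le> 1}" for n
  proof clarify
    fix x assume "\<phi> n x \<noteq> 0"
    then have "real (Suc n) * infdist x K < 1" by (auto simp: \<phi>_def max_def split: if_splits)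
    moreover have "1 * infdist x K \<le> real (Suc n) * infdist x K"
      by (intro mult_right_mono infdist_nonneg) auto
    ultimately show "infdist x K \<le> 1" by linarith
  qed
  have cpt: "compact {x. infdist x K \<le> 1}"
    using compact_infdist_le[OF ne K, of 1] by simp
  have cc: "\<phi> n \<in> Cc" for n
  proof -
    have "closure {x. \<phi> n x \<noteq> 0} \<subseteq> {x. infdist x K \<le> 1}"
      using supp[of n] cpt by (simp add: closure_minimal compact_imp_closed)
    then have "compact (closure {x. \<phi> n x \<noteq> 0})"
      using cpt by (metis closed_closure compact_Int_closed inf.absorb_iff2)
    then show ?thesis
      unfolding Cc_def by (auto simp: \<phi>_def[abs_def] intro!: continuous_intros)
  qed
  have dom: "\<bar>\<phi> n x\<bar> \<le> \<phi> 0 x" for n x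
  proof -
    have "1 * infdist x K \<le> real (Suc n) * infdist x K"
      by (intro mult_right_mono infdist_nonneg) auto
    then show ?thesis by (auto simp: \<phi>_def max_def)
  qed
  have lim: "(\<lambda>n. \<phi> n x) \<longlonglongrightarrow> indicator K x" for x
  proof (cases "x \<in> K")
    case False
    then have pos: "0 < infdist x K"
      using ne K by (metis compact_imp_closed in_closed_iff_infdist_zero infdist_nonneg less_eq_real_def)
    obtain n0 where n0: "1 < real n0 * infdist x K"
      using reals_Archimedean3[OF pos] by blast
    have "\<phi> n x = 0" if "n \<ge> n0" for n
    proof -
      have "real n0 * infdist x K \<le> real (Suc n) * infdist x K"
        using that pos by (intro mult_right_mono) auto
      with n0 show ?thesis by (simp add: \<phi>_def)
    qed
    then have "eventually (\<lambda>n. \<phi> n x = 0) sequentially"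
      using eventually_sequentially by blast
    then show ?thesis using False by (simp add: tendsto_eventually)
  qed (simp add: \<phi>_def)
  show ?thesis
  proof (rule that[of \<phi>])
    fix M :: "'a measure" assume M: "radon_measure M"
    then have s: "sets M = sets borel" by (simp add: radon_measure_def)
    have Ks: "K \<in> sets M" using K s by (simp add: borel_compact)
    have "(\<lambda>n. integral\<^sup>L M (\<phi> n)) \<longlonglongrightarrow> integral\<^sup>L M (indicator K)"
    proof (rule integral_dominated_convergence[where w="\<phi> 0"])
      show "integrable M (\<phi> 0)" by (rule Cc_integrable[OF M cc])
      show "\<phi> n \<in> borel_measurable M" for n
        using Cc_integrable[OF M cc] by blast
    qed (use dom lim Ks in auto)
    then show "(\<lambda>n. integral\<^sup>L M (\<phi> n)) \<longlonglongrightarrow> measure M K"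
      using Ks sets.sets_into_space by (auto simp: Int_absorb2)
  qed (use cc in \<open>auto simp: \<phi>_def\<close>)
qed

lemma radon_emeasure_compact:
  assumes "radon_measure M" "compact K"
  shows "emeasure M K = ennreal (measure M K)"
  using assms by (intro emeasure_eq_ennreal_measure) (auto simp: radon_measure_def less_top)

text \<open>Compact sets are closed under intersection and generate the Borel sets, because a closed set is a countable union of compact ones.\<close>

lemma radon_measure_eqI:
  fixes M N :: "'a::euclidean_space measure"
  assumes M: "radon_measure M" and N: "radon_measure N"
    and eq: "\<And>K. compact K \<Longrightarrow> emeasure M K = emeasure N K"
  shows "M = N"
proof (rule measure_eqI_generator_eq[where E="Collect compact" and \<Omega>=UNIV and A="\<lambda>n. cball 0 (real n)"])
  have *: "sets borel = sigma_sets UNIV (Collect compact :: 'a set set)"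
  proof
    have "closed X \<Longrightarrow> X \<in> sigma_sets UNIV (Collect compact)" for X :: "'a set"
    proof -
      assume X: "closed X"
      have "X = (\<Union>n. X \<inter> cball 0 (real n))"
        using real_arch_simple by (auto simp: dist_norm)
      also have "\<dots> \<in> sigma_sets UNIV (Collect compact)"
        using X by (intro sigma_sets.Union sigma_sets.Basic) (auto intro: closed_Int_compact)
      finally show ?thesis .
    qed
    then show "sets borel \<subseteq> sigma_sets UNIV (Collect compact :: 'a set set)"
      unfolding borel_eq_closed by (auto intro!: sigma_sets_mono)
  next
    have *: "(Collect compact :: 'a set set) \<subseteq> sets borel"
      by (auto intro: borel_compact)
    show "sigma_sets UNIV (Collect compact :: 'a set set) \<subseteq> sets borel"
      using sets.sigma_sets_subset[of "Collect compact :: 'a set set" borel] * by simp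
  qed
  then show "sets M = sigma_sets UNIV (Collect compact)" "sets N = sigma_sets UNIV (Collect compact)"
    using M N by (auto simp: radon_measure_def)
  show "(\<Union>n. cball (0::'a) (real n)) = UNIV"
    using real_arch_simple by (auto simp: dist_norm)
  show "emeasure M (cball 0 (real n)) \<noteq> \<infinity>" for n
    using M by (auto simp: radon_measure_def less_top[symmetric])
qed (use eq in \<open>auto simp: Int_stable_def intro: compact_Int\<close>)

lemma emeasure_split:
  assumes "A \<in> sets M" "B \<in> sets M" "- A \<in> sets M"
  shows "emeasure M B = emeasure M (B \<inter> A) + emeasure M (B \<inter> - A)"
proof -
  have "emeasure M (B \<inter> A) + emeasure M (B \<inter> - A) = emeasure M (B \<inter> A \<union> B \<inter> - A)"
    using assms by (intro plus_emeasure) auto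
  also have "B \<inter> A \<union> B \<inter> - A = B" by blast
  finally show ?thesis ..
qed

text \<open>
  Two decompositions of \<open>\<mu>\<close> give \<open>P + N' = P' + N\<close> as measures. Splitting the space along the null sets \<open>A\<close> of \<open>P\<close> and \<open>A'\<close>
  of \<open>P'\<close>, whose complements are null for \<open>N\<close> and \<open>N'\<close>, this identity forces \<open>P\<close> and \<open>P'\<close> to agree on each of the four pieces.
  No subtraction occurs, so infinite values do no harm.
\<close>

lemma jordan_decomposition_eq:
  fixes \<mu> :: "('a::euclidean_space) radon"
  assumes J: "jordan_decomposition \<mu> P N" and J': "jordan_decomposition \<mu> P' N'"
  shows "P = P'"
proof -
  have r: "radon_measure P" "radon_measure N" "radon_measure P'" "radon_measure N'"
    using J J' by (auto simp: jordan_decomposition_def)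
  then have s[simp]: "sets P = sets borel" "sets N = sets borel" "sets P' = sets borel" "sets N' = sets borel"
    by (auto simp: radon_measure_def)
  have plus_eq: "measure_plus P N' = measure_plus P' N"
  proof (rule radon_measure_eqI)
    fix K :: "'a set" assume K: "compact K"
    obtain \<phi> where \<phi>: "\<And>n. \<phi> n \<in> Cc"
        "\<And>M. radon_measure M \<Longrightarrow> (\<lambda>n. integral\<^sup>L M (\<phi> n)) \<longlonglongrightarrow> measure M K"
      using Cc_approx_indicator[OF K] by metis
    have "integral\<^sup>L P (\<phi> n) + integral\<^sup>L N' (\<phi> n) = integral\<^sup>L P' (\<phi> n) + integral\<^sup>L N (\<phi> n)" for n
    proof -
      have "\<mu> (\<phi> n) = integral\<^sup>L P (\<phi> n) - integral\<^sup>L N (\<phi> n)"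
        "\<mu> (\<phi> n) = integral\<^sup>L P' (\<phi> n) - integral\<^sup>L N' (\<phi> n)"
        using J J' \<phi>(1)[of n] unfolding jordan_decomposition_def by blast+
      then show ?thesis by linarith
    qed
    then have "measure P K + measure N' K = measure P' K + measure N K"
      using LIMSEQ_unique[OF tendsto_add[OF \<phi>(2)[OF r(1)] \<phi>(2)[OF r(4)]]]
        tendsto_add[OF \<phi>(2)[OF r(3)] \<phi>(2)[OF r(2)]] by simp
    then show "emeasure (measure_plus P N') K = emeasure (measure_plus P' N) K"
      using r K by (simp add: emeasure_measure_plus borel_compact radon_emeasure_compact flip: ennreal_plus)
  qed (use r radon_measure_plus in auto)
  then have eq: "emeasure P B + emeasure N' B = emeasure P' B + emeasure N B" if "B \<in> sets borel" for B
    unfolding emeasure_measure_plus[OF s(1) s(4) that, symmetric]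
      emeasure_measure_plus[OF s(3) s(2) that, symmetric]
    by (simp only: plus_eq)
  obtain A A' where A: "A \<in> sets borel" "emeasure P A = 0" "emeasure N (- A) = 0"
    and A': "A' \<in> sets borel" "emeasure P' A' = 0" "emeasure N' (- A') = 0"
    using J J' by (auto simp: jordan_decomposition_def mutually_singular_def)
  show ?thesis
  proof (rule measure_eqI)
    fix B assume "B \<in> sets P"
    then have B: "B \<in> sets borel" by simp
    have cA: "-A \<in> sets borel" "-A' \<in> sets borel" using A(1) A'(1) by auto
    have null: "C \<subseteq> A \<Longrightarrow> emeasure P C = 0" "C \<subseteq> - A \<Longrightarrow> emeasure N C = 0"
      "C \<subseteq> A' \<Longrightarrow> emeasure P' C = 0" "C \<subseteq> - A' \<Longrightarrow> emeasure N' C = 0" for C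
      using A A' cA emeasure_eq_0[of A P] emeasure_eq_0[of "- A" N]
        emeasure_eq_0[of A' P'] emeasure_eq_0[of "- A'" N'] by auto
    \<comment> \<open>\<open>P\<close> lives on \<open>- A\<close> and \<open>P'\<close> on \<open>- A'\<close>; only the common piece \<open>- A \<inter> - A'\<close> will contribute to either.\<close>
    have 1: "emeasure P B = emeasure P (B \<inter> A) + emeasure P (B \<inter> - A)"
      using B A by (intro emeasure_split) auto
    have 2: "emeasure P (B \<inter> - A) = emeasure P (B \<inter> - A \<inter> A') + emeasure P (B \<inter> - A \<inter> - A')"
      using B A A' by (intro emeasure_split) auto
    have 3: "emeasure P' B = emeasure P' (B \<inter> A') + emeasure P' (B \<inter> - A')"
      using B A' by (intro emeasure_split) auto
    have 4: "emeasure P' (B \<inter> - A') = emeasure P' (B \<inter> - A' \<inter> A) + emeasure P' (B \<inter> - A' \<inter> - A)"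
      using B A A' by (intro emeasure_split) auto
    have "emeasure P (B \<inter> - A \<inter> A') = 0"
      using eq[of "B \<inter> - A \<inter> A'"] null(2)[of "B \<inter> - A \<inter> A'"] null(3)[of "B \<inter> - A \<inter> A'"] B A(1) A'(1) cA
      by (simp add: le_infI1 le_infI2)
    moreover have "emeasure P' (B \<inter> - A' \<inter> A) = 0"
      using eq[of "B \<inter> - A' \<inter> A"] null(1)[of "B \<inter> - A' \<inter> A"] null(4)[of "B \<inter> - A' \<inter> A"] B A(1) A'(1) cA
      by (simp add: le_infI1 le_infI2)
    moreover have "emeasure P (B \<inter> - A \<inter> - A') = emeasure P' (B \<inter> - A \<inter> - A')"
      using eq[of "B \<inter> - A \<inter> - A'"] null(2)[of "B \<inter> - A \<inter> - A'"] null(4)[of "B \<inter> - A \<inter> - A'"] B A(1) A'(1) cA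
      by (simp add: le_infI1 le_infI2)
    moreover have "B \<inter> - A' \<inter> - A = B \<inter> - A \<inter> - A'" by blast
    ultimately show "emeasure P B = emeasure P' B"
      using 1 2 3 4 null(1)[of "B \<inter> A"] null(3)[of "B \<inter> A'"] by simp
  qed simp
qed

text \<open>Exchanging the two parts makes uniqueness of the negative part a case of uniqueness of the positive part.\<close>

lemma jordan_decomposition_swap:
  assumes "jordan_decomposition \<mu> P N"
  shows "jordan_decomposition (\<lambda>\<phi>. - \<mu> \<phi>) N P"
proof -
  obtain A where "A \<in> sets borel" "emeasure P A = 0" "emeasure N (- A) = 0"
    using assms by (auto simp: jordan_decomposition_def mutually_singular_def)
  then have "mutually_singular N P"
    unfolding mutually_singular_def by (intro bexI[of _ "- A"]) auto
  then show ?thesis using assms by (auto simp: jordan_decomposition_def)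
qed

lemma jordan_parts_eq:
  assumes "jordan_decomposition \<mu> P N"
  shows "jordan_parts \<mu> = (P, N)"
  unfolding jordan_parts_def
proof (rule the_equality)
  fix PN assume "jordan_decomposition \<mu> (fst PN) (snd PN)"
  then show "PN = (P, N)"
    using assms jordan_decomposition_eq[of \<mu>] jordan_decomposition_eq[of "\<lambda>\<phi>. - \<mu> \<phi>"]
      jordan_decomposition_swap by (metis prod.collapse)
qed (use assms in simp)

text \<open>
  Testing \<open>\<mu> \<ge> 0\<close> with tent functions gives \<open>N K \<le> P K\<close> for compact \<open>K\<close>, so \<open>N\<close> vanishes on the compact subsets of a \<open>P\<close>-null set
  and, by inner regularity, on the null set itself. Inner regularity holds for finite measures, hence the
  restriction of \<open>N\<close> to balls.
\<close>

lemma radon_nonneg_null_negative_part: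
  fixes \<mu> :: "('a::euclidean_space) radon"
  assumes J: "jordan_decomposition \<mu> P N" and nn: "radon_nonneg \<mu>"
    and A: "A \<in> sets borel" "emeasure P A = 0"
  shows "emeasure N A = 0"
proof -
  have r: "radon_measure P" "radon_measure N"
    using J by (auto simp: jordan_decomposition_def)
  then have s: "sets P = sets borel" "sets N = sets borel"
    by (auto simp: radon_measure_def)
  have K0: "emeasure N K = 0" if K: "compact K" "K \<subseteq> A" for K
  proof -
    obtain \<phi> where \<phi>: "\<And>n. \<phi> n \<in> Cc" "\<And>n x. 0 \<le> \<phi> n x"
        "\<And>M. radon_measure M \<Longrightarrow> (\<lambda>n. integral\<^sup>L M (\<phi> n)) \<longlonglongrightarrow> measure M K"
      using Cc_approx_indicator[OF K(1)] by metis
    have "integral\<^sup>L N (\<phi> n) \<le> integral\<^sup>L P (\<phi> n)" for n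
      using J nn \<phi>(1,2) by (auto simp: jordan_decomposition_def radon_nonneg_def)
    then have "measure N K \<le> measure P K"
      using \<phi>(3) r by (blast intro: LIMSEQ_le)
    also have "emeasure P K = 0"
      using A K s by (auto intro: emeasure_eq_0)
    then have "measure P K = 0" by (simp add: measure_def)
    finally show ?thesis using radon_emeasure_compact[OF r(2) K(1)] by (simp add: measure_le_0_iff)
  qed
  have ball0: "emeasure N (A \<inter> cball 0 (real n)) = 0" for n
  proof -
    define D where "D = density N (indicator (cball 0 (real n)))"
    have D: "emeasure D B = emeasure N (cball 0 (real n) \<inter> B)" if "B \<in> sets borel" for B
      using that s unfolding D_def by (intro emeasure_restricted) auto
    have sD: "sets D = sets borel" by (simp add: D_def s)
    then have "space D = UNIV" using sets_eq_imp_space_eq[OF sD] by simp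
    then have fin: "emeasure D (space D) \<noteq> \<infinity>"
      using D[of UNIV] r(2) by (auto simp: radon_measure_def less_top[symmetric])
    have "emeasure D A = (SUP K \<in> {K. K \<subseteq> A \<and> compact K}. emeasure D K)"
      using inner_regular[OF sD fin A(1)] .
    also have "\<dots> \<le> 0"
    proof (rule SUP_least)
      fix K assume K: "K \<in> {K. K \<subseteq> A \<and> compact K}"
      then have "emeasure D K \<le> emeasure N K"
        using D[of K] s by (auto simp: borel_compact intro!: emeasure_mono)
      then show "emeasure D K \<le> 0" using K0 K by auto
    qed
    finally show ?thesis using D[OF A(1)] by (simp add: Int_commute)
  qed
  have "emeasure N (\<Union>n. A \<inter> cball 0 (real n)) = 0"
    using A s ball0 by (intro emeasure_UN_eq_0) auto
  moreover have "(\<Union>n. A \<inter> cball 0 (real n)) = A"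
    using real_arch_simple by (auto simp: dist_norm)
  ultimately show ?thesis by simp
qed

text \<open>
  Collapsing the two parts of \<open>\<mu>\<close> into the single measure \<open>|\<mu>|\<close> with a density of modulus one
  reduces every later integral against \<open>\<mu>\<close> to one Bochner integral.
\<close>

proposition M_eps_polar:
  fixes \<mu> :: "('a::euclidean_space) radon"
  assumes "\<mu> \<in> M_eps \<epsilon>"
  obtains M and h :: "'a \<Rightarrow> real"
  where "radon_measure M" "h \<in> borel_measurable borel" "\<And>y. \<bar>h y\<bar> = 1"
    "integrable M (\<lambda>y. exp (- \<epsilon> * (norm y)\<^sup>2))"
    "\<And>f. integrable M f \<Longrightarrow> radon_integrable \<mu> f"
    "\<And>f. integrable M f \<Longrightarrow> radon_integral \<mu> f = (\<integral>y. h y * f y \<partial>M)"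
    "radon_nonneg \<mu> \<Longrightarrow> AE y in M. h y = 1"
    "radon_nonzero \<mu> \<Longrightarrow> emeasure M UNIV \<noteq> 0"
proof -
  obtain P N where J: "jordan_decomposition \<mu> P N"
    and fin: "(\<integral>\<^sup>+x. ennreal (exp (- \<epsilon> * (norm x)\<^sup>2)) \<partial>measure_plus P N) < \<infinity>"
    using assms by (auto simp: M_eps_def)
  obtain A where A: "A \<in> sets borel" "emeasure P A = 0" "emeasure N (- A) = 0"
    using J by (auto simp: jordan_decomposition_def mutually_singular_def)
  have r: "radon_measure P" "radon_measure N"
    using J by (auto simp: jordan_decomposition_def)
  then have s: "sets P = sets borel" "sets N = sets borel"
    by (auto simp: radon_measure_def)
  define M where "M = measure_plus P N"
  have sM: "sets M = sets borel" by (simp add: M_def sets_measure_plus)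
  have mM[measurable_cong]: "sets M = sets borel" by (rule sM)
  note [measurable] = A(1)
  have em: "emeasure M B = emeasure P B + emeasure N B" if "B \<in> sets borel" for B
    unfolding M_def by (rule emeasure_measure_plus[OF s that])
  have P_eq: "P = density M (\<lambda>x. ennreal (indicator (- A) x))"
  proof (rule measure_eqI)
    fix B assume "B \<in> sets P"
    then have B[measurable]: "B \<in> sets borel" by (simp add: s)
    have "emeasure (density M (\<lambda>x. ennreal (indicator (- A) x))) B = emeasure M (- A \<inter> B)"
      unfolding ennreal_indicator using A(1) B by (intro emeasure_restricted) (auto simp: sM)
    also have "\<dots> = emeasure P (- A \<inter> B)"
      using emeasure_eq_0[of "- A" N "- A \<inter> B"] em[of "- A \<inter> B"] A s B by simp
    also have "\<dots> = emeasure P B"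
      using emeasure_split[of A P B] emeasure_eq_0[of A P "B \<inter> A"] A s B by (simp add: Int_commute)
    finally show "emeasure P B = emeasure (density M (\<lambda>x. ennreal (indicator (- A) x))) B" ..
  qed (simp add: s sM)
  have N_eq: "N = density M (\<lambda>x. ennreal (indicator A x))"
  proof (rule measure_eqI)
    fix B assume "B \<in> sets N"
    then have B[measurable]: "B \<in> sets borel" by (simp add: s)
    have "emeasure (density M (\<lambda>x. ennreal (indicator A x))) B = emeasure M (A \<inter> B)"
      unfolding ennreal_indicator using A(1) B by (intro emeasure_restricted) (auto simp: sM)
    also have "\<dots> = emeasure N (A \<inter> B)"
      using emeasure_eq_0[of A P "A \<inter> B"] em[of "A \<inter> B"] A s B by simp
    also have "\<dots> = emeasure N B"
      using emeasure_split[of A N B] emeasure_eq_0[of "- A" N "B \<inter> - A"] A s B by (simp add: Int_commute)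
    finally show "emeasure N B = emeasure (density M (\<lambda>x. ennreal (indicator A x))) B" ..
  qed (simp add: s sM)
  \<comment> \<open>\<open>P\<close> lives on \<open>- A\<close> and \<open>N\<close> on \<open>A\<close>.\<close>
  define h :: "'a \<Rightarrow> real" where "h y = indicator (- A) y - indicator A y" for y
  have hm: "h \<in> borel_measurable borel" unfolding h_def by measurable
  have parts: "jordan_parts \<mu> = (P, N)" by (rule jordan_parts_eq[OF J])
  have ints: "integrable P f" "integrable N f"
      "integral\<^sup>L P f = (\<integral>y. indicator (- A) y * f y \<partial>M)"
      "integral\<^sup>L N f = (\<integral>y. indicator A y * f y \<partial>M)"
      "integrable M (\<lambda>y. indicator (- A) y * f y)" "integrable M (\<lambda>y. indicator A y * f y)"
    if f: "integrable M f" for f :: "'a \<Rightarrow> real"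
  proof -
    have fm[measurable]: "f \<in> borel_measurable M" using f by auto
    show i: "integrable M (\<lambda>y. indicator (- A) y * f y)" "integrable M (\<lambda>y. indicator A y * f y)"
      by (rule Bochner_Integration.integrable_bound[OF f]; auto simp: indicator_def)+
    show "integrable P f" "integral\<^sup>L P f = (\<integral>y. indicator (- A) y * f y \<partial>M)"
      unfolding P_eq using i by (auto simp: integrable_real_density integral_real_density)
    show "integrable N f" "integral\<^sup>L N f = (\<integral>y. indicator A y * f y \<partial>M)"
      unfolding N_eq using i by (auto simp: integrable_real_density integral_real_density)
  qed
  show ?thesis
  proof (rule that[of M h])
    show "radon_measure M" unfolding M_def by (rule radon_measure_plus[OF r])
    show "integrable M (\<lambda>y. exp (- \<epsilon> * (norm y)\<^sup>2))"
      using fin unfolding M_def[symmetric] by (intro integrableI_bounded) auto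
    show "radon_integrable \<mu> f" if "integrable M f" for f
      using ints[OF that] by (simp add: radon_integrable_def parts)
    show "radon_integral \<mu> f = (\<integral>y. h y * f y \<partial>M)" if "integrable M f" for f
      using ints[OF that] by (simp add: radon_integral_def parts h_def left_diff_distrib)
    show "AE y in M. h y = 1" if "radon_nonneg \<mu>"
    proof (rule AE_I[of _ _ A])
      show "emeasure M A = 0"
        using radon_nonneg_null_negative_part[OF J that A(1,2)] em[OF A(1)] A(2) by simp
    qed (auto simp: h_def indicator_def)
    show "emeasure M UNIV \<noteq> 0" if nz: "radon_nonzero \<mu>"
    proof
      assume "emeasure M UNIV = 0"
      then have 0: "emeasure P UNIV = 0" "emeasure N UNIV = 0" using em[of UNIV] by auto
      have sp: "space P = UNIV" "space N = UNIV"
        using s[THEN sets_eq_imp_space_eq] by auto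
      have "AE x in P. \<phi> x = 0" "AE x in N. \<phi> x = 0" for \<phi> :: "'a \<Rightarrow> real"
        using 0 s sp by (auto intro!: AE_I[of _ _ UNIV])
      then have "integral\<^sup>L P \<phi> = 0" "integral\<^sup>L N \<phi> = 0" for \<phi> :: "'a \<Rightarrow> real"
        by (auto intro: integral_eq_zero_AE)
      then show False using nz J by (auto simp: radon_nonzero_def jordan_decomposition_def)
    qed
  qed (auto simp: hm h_def indicator_def)
qed

section \<open>Calculus of \<open>C\<^sup>k\<close> functions\<close>

text \<open>Openness of \<open>S\<close> makes the derivatives at points of \<open>S\<close> depend only on the values in \<open>S\<close>.\<close>

lemma Ck_on_cong:
  assumes "open S" "Ck_on k f S" "\<And>x. x \<in> S \<Longrightarrow> f x = g x"
  shows "Ck_on k g S"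
  using assms(2,3)
proof (induction k arbitrary: f g)
  case 0
  then show ?case by (auto cong: continuous_on_cong)
next
  case (Suc k)
  have d: "f differentiable (at x)" if "x \<in> S" for x
    using Suc.prems that by auto
  have "g differentiable (at x)" if "x \<in> S" for x
    using d[OF that] Suc.prems(2) \<open>open S\<close> that
    by (auto simp: differentiable_def intro: has_derivative_transform_within_open)
  moreover have "Ck_on k (\<lambda>x. frechet_derivative g (at x) v) S" for v
  proof (rule Suc.IH)
    show "Ck_on k (\<lambda>x. frechet_derivative f (at x) v) S" using Suc.prems by auto
    show "frechet_derivative f (at x) v = frechet_derivative g (at x) v" if "x \<in> S" for x
      using frechet_derivative_transform_within_open[OF d[OF that] \<open>open S\<close> that] Suc.prems(2) by simp
  qed
  ultimately show ?case by simp
qed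

lemma Ck_on_SucI:
  assumes "open S" "\<And>x. x \<in> S \<Longrightarrow> (f has_derivative f' x) (at x)"
    and "\<And>v. Ck_on k (\<lambda>x. f' x v) S"
  shows "Ck_on (Suc k) f S"
proof -
  have "Ck_on k (\<lambda>x. frechet_derivative f (at x) v) S" for v
    using assms(1) assms(3)[of v]
    by (rule Ck_on_cong) (simp add: frechet_derivative_at[OF assms(2)])
  then show ?thesis
    using assms(2) by (auto simp: differentiable_def)
qed

lemma Ck_on_has_derivative:
  assumes "Ck_on (Suc k) f S" "x \<in> S"
  shows "(f has_derivative frechet_derivative f (at x)) (at x)"
  using assms by (simp add: frechet_derivative_works[symmetric])

lemma Ck_on_SucD:
  assumes "Ck_on (Suc k) f S"
  shows "Ck_on k f S"
  using assms
proof (induction k arbitrary: f)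
  case 0
  then show ?case
    by (auto intro!: continuous_at_imp_continuous_on differentiable_imp_continuous_within)
next
  case (Suc k)
  then show ?case by (metis Ck_on.simps(2))
qed

lemma Ck_on_const: "Ck_on k (\<lambda>x. c) S"
  by (induction k arbitrary: c) auto

lemma Ck_on_add:
  assumes "open S" "Ck_on k f S" "Ck_on k g S"
  shows "Ck_on k (\<lambda>x. f x + g x) S"
  using assms(2,3)
proof (induction k arbitrary: f g)
  case 0
  then show ?case by (auto intro: continuous_intros)
next
  case (Suc k)
  show ?case
  proof (rule Ck_on_SucI[OF \<open>open S\<close>])
    show "((\<lambda>x. f x + g x) has_derivative
        (\<lambda>v. frechet_derivative f (at x) v + frechet_derivative g (at x) v)) (at x)" if "x \<in> S" for x
      using Suc.prems[THEN Ck_on_has_derivative, OF that] by (rule has_derivative_add)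
  qed (use Suc in auto)
qed

lemma Ck_on_sum:
  assumes "open S" "\<And>i. i \<in> I \<Longrightarrow> Ck_on k (f i) S"
  shows "Ck_on k (\<lambda>x. \<Sum>i\<in>I. f i x) S"
  using assms(2) by (induction I rule: infinite_finite_induct) (auto intro: Ck_on_const Ck_on_add \<open>open S\<close>)

lemma Ck_on_mult:
  assumes "open S" "Ck_on k f S" "Ck_on k g S"
  shows "Ck_on k (\<lambda>x. f x * g x) S"
  using assms(2,3)
proof (induction k arbitrary: f g)
  case 0
  then show ?case by (auto intro: continuous_intros)
next
  case (Suc k)
  show ?case
  proof (rule Ck_on_SucI[OF \<open>open S\<close>])
    show "((\<lambda>x. f x * g x) has_derivative
        (\<lambda>v. f x * frechet_derivative g (at x) v + frechet_derivative f (at x) v * g x)) (at x)" if "x \<in> S" for x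
      using Suc.prems[THEN Ck_on_has_derivative, OF that] by (rule has_derivative_mult)
    show "Ck_on k (\<lambda>x. f x * frechet_derivative g (at x) v + frechet_derivative f (at x) v * g x) S" for v
      using Suc.prems Suc.prems[THEN Ck_on_SucD] by (intro Ck_on_add \<open>open S\<close> Suc.IH) auto
  qed
qed

lemma Ck_on_linear:
  assumes "open S" "bounded_linear f"
  shows "Ck_on k f S"
proof (cases k)
  case 0
  then show ?thesis using linear_continuous_on[OF assms(2)] by simp
next
  case (Suc j)
  show ?thesis unfolding Suc
    by (rule Ck_on_SucI[OF assms(1)])
      (auto intro: bounded_linear_imp_has_derivative assms Ck_on_const)
qed

lemma Ck_on_exp: "Ck_on k (exp :: real \<Rightarrow> real) UNIV"
proof (induction k)
  case (Suc k)
  show ?case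
  proof (rule Ck_on_SucI)
    show "(exp has_derivative (\<lambda>v. exp x * v)) (at x)" for x :: real
      using DERIV_exp by (simp add: has_field_derivative_def)
    show "Ck_on k (\<lambda>x. exp x * v) UNIV" for v :: real
      by (intro Ck_on_mult Suc Ck_on_const) auto
  qed auto
qed (auto intro: continuous_intros)

lemma Ck_on_powr: "Ck_on k (\<lambda>x::real. x powr p) {0<..}"
proof (induction k arbitrary: p)
  case (Suc k)
  show ?case
  proof (rule Ck_on_SucI)
    show "((\<lambda>x. x powr p) has_derivative (\<lambda>v. p * x powr (p - 1) * v)) (at x)"
      if "x \<in> {0<..}" for x :: real
      using has_real_derivative_powr[of x p] that by (simp add: has_field_derivative_def)
    show "Ck_on k (\<lambda>x. p * x powr (p - 1) * v) {0<..}" for v :: real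
      by (intro Ck_on_mult Suc Ck_on_const) auto
  qed auto
qed (auto intro!: continuous_intros)

text \<open>
  The chain rule writes \<open>D(F \<circ> \<zeta>)(x)v\<close> as \<open>\<Sum>\<^sub>c D\<zeta>\<^sub>c(x)v \<cdot> (\<partial>\<^sub>c F)(\<zeta> x)\<close>, whose factors are one
  degree less smooth; so the claim for \<open>k\<close> gives the claim for \<open>k + 1\<close>.
\<close>

lemma Ck_on_compose:
  fixes F :: "'b::euclidean_space \<Rightarrow> real" and \<zeta> :: "'a::real_normed_vector \<Rightarrow> 'b"
  assumes S: "open S" and S': "open S'" and im: "\<And>x. x \<in> S \<Longrightarrow> \<zeta> x \<in> S'"
    and F: "Ck_on k F S'" and \<zeta>: "\<And>c. c \<in> Basis \<Longrightarrow> Ck_on k (\<lambda>x. \<zeta> x \<bullet> c) S"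
  shows "Ck_on k (\<lambda>x. F (\<zeta> x)) S"
  using F \<zeta>
proof (induction k arbitrary: F)
  case 0
  have "continuous_on S \<zeta>"
    using 0(2) by (subst continuous_on_componentwise) simp
  then show ?case
    using continuous_on_compose2[of S' F S \<zeta>] 0(1) im by auto
next
  case (Suc k)
  define D where "D x v = (\<Sum>c\<in>Basis. frechet_derivative (\<lambda>x. \<zeta> x \<bullet> c) (at x) v *\<^sub>R c)" for x v
  have D: "(\<zeta> has_derivative D x) (at x)" if "x \<in> S" for x
  proof (subst has_derivative_componentwise_within, rule ballI)
    fix c :: 'b assume c: "c \<in> Basis"
    then have "(\<lambda>v. D x v \<bullet> c) = frechet_derivative (\<lambda>x. \<zeta> x \<bullet> c) (at x)"
      by (simp add: D_def)
    then show "((\<lambda>x. \<zeta> x \<bullet> c) has_derivative (\<lambda>v. D x v \<bullet> c)) (at x)"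
      using Ck_on_has_derivative[OF Suc.prems(2)[OF c] that] by simp
  qed
  have dF: "(F has_derivative frechet_derivative F (at (\<zeta> x))) (at (\<zeta> x))" if "x \<in> S" for x
    using Suc.prems(1) im[OF that] by (rule Ck_on_has_derivative)
  show ?case
  proof (rule Ck_on_SucI[OF S])
    show "((\<lambda>x. F (\<zeta> x)) has_derivative (\<lambda>v. \<Sum>c\<in>Basis.
        frechet_derivative (\<lambda>x. \<zeta> x \<bullet> c) (at x) v * frechet_derivative F (at (\<zeta> x)) c)) (at x)"
      if x: "x \<in> S" for x
    proof -
      have "linear (frechet_derivative F (at (\<zeta> x)))"
        using dF[OF x] has_derivative_linear by blast
      then have "frechet_derivative F (at (\<zeta> x)) (D x v) = (\<Sum>c\<in>Basis.
          frechet_derivative (\<lambda>x. \<zeta> x \<bullet> c) (at x) v * frechet_derivative F (at (\<zeta> x)) c)" for v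
        by (simp add: D_def linear_sum linear_scale)
      then show ?thesis
        using has_derivative_compose[OF D[OF x] dF[OF x]] by simp
    qed
    show "Ck_on k (\<lambda>x. \<Sum>c\<in>Basis.
        frechet_derivative (\<lambda>x. \<zeta> x \<bullet> c) (at x) v * frechet_derivative F (at (\<zeta> x)) c) S" for v
    proof (intro Ck_on_sum Ck_on_mult S)
      fix c :: 'b assume c: "c \<in> Basis"
      show "Ck_on k (\<lambda>x. frechet_derivative (\<lambda>x. \<zeta> x \<bullet> c) (at x) v) S"
        using Suc.prems(2)[OF c] by simp
      show "Ck_on k (\<lambda>x. frechet_derivative F (at (\<zeta> x)) c) S"
      proof (rule Suc.IH)
        show "Ck_on k (\<lambda>z. frechet_derivative F (at z) c) S'"
          using Suc.prems(1) by simp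
      qed (rule Ck_on_SucD[OF Suc.prems(2)])
    qed
  qed
qed

section \<open>Laplace transforms are smooth\<close>

text \<open>
  Let \<open>n\<close> be the dimension. The finitely many points \<open>z \<plusminus> n\<delta>b\<close>, with \<open>b\<close> a basis vector and \<open>\<delta>\<close> small, lie in the open domain
  of convergence. They control \<open>exp (\<delta>|g|)\<close>, because some coordinate of \<open>g y\<close> is at least \<open>|g y| / n\<close> in modulus.
\<close>

lemma laplace_integrable_margin:
  fixes g :: "'a \<Rightarrow> 'v::euclidean_space" and w :: "'a \<Rightarrow> real"
  assumes g: "g \<in> borel_measurable M" and w: "w \<in> borel_measurable M"
    and S: "open S" and z: "z \<in> S"
    and int: "\<And>z. z \<in> S \<Longrightarrow> integrable M (\<lambda>y. w y * exp (z \<bullet> g y))"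
  obtains \<delta> where "0 < \<delta>" "integrable M (\<lambda>y. \<bar>w y\<bar> * exp (\<delta> * norm (g y)) * exp (z \<bullet> g y))"
proof -
  obtain e where e: "0 < e" "\<And>z'. dist z' z < e \<Longrightarrow> z' \<in> S"
    using S z by (auto simp: open_dist)
  define n where "n = real DIM('v)"
  have n: "0 < n" by (simp add: n_def)
  define \<delta> where "\<delta> = e / (2 * n)"
  have \<delta>: "0 < \<delta>" "n * \<delta> < e" using e(1) n by (auto simp: \<delta>_def)
  let ?D = "\<lambda>y. \<Sum>b\<in>Basis. \<bar>w y * exp ((z + (n * \<delta>) *\<^sub>R b) \<bullet> g y)\<bar> + \<bar>w y * exp ((z - (n * \<delta>) *\<^sub>R b) \<bullet> g y)\<bar>"
  have "integrable M ?D"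
    using \<delta> n by (intro Bochner_Integration.integrable_sum Bochner_Integration.integrable_add integrable_abs int e(2))
      (auto simp: dist_norm abs_mult)
  moreover have "\<bar>w y\<bar> * exp (\<delta> * norm (g y)) * exp (z \<bullet> g y) \<le> ?D y" for y
  proof -
    obtain b where b: "b \<in> Basis" "norm (g y) \<le> n * \<bar>g y \<bullet> b\<bar>"
    proof -
      have ex: "\<exists>b\<in>Basis. norm (g y) \<le> n * \<bar>g y \<bullet> b\<bar>"
      proof (rule ccontr)
        assume "\<not> ?thesis"
        then have "\<bar>g y \<bullet> b\<bar> < norm (g y) / n" if "b \<in> Basis" for b
          using n that by (auto simp: field_simps not_le)
        then have "(\<Sum>b\<in>Basis. \<bar>g y \<bullet> b\<bar>) < (\<Sum>b\<in>(Basis::'v set). norm (g y) / n)"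
          by (intro sum_strict_mono) auto
        then show False using norm_le_l1[of "g y"] n by (simp add: n_def)
      qed
      then show ?thesis using that by blast
    qed
    let ?t = "\<lambda>b. \<bar>w y * exp ((z + (n * \<delta>) *\<^sub>R b) \<bullet> g y)\<bar> + \<bar>w y * exp ((z - (n * \<delta>) *\<^sub>R b) \<bullet> g y)\<bar>"
    have hle: "\<delta> * norm (g y) \<le> \<delta> * (n * \<bar>g y \<bullet> b\<bar>)"
      using b \<delta> by (intro mult_left_mono) auto
    have "exp (\<delta> * norm (g y)) \<le> exp (n * \<delta> * (g y \<bullet> b)) + exp (- (n * \<delta> * (g y \<bullet> b)))"
    proof (cases "0 \<le> g y \<bullet> b")
      case True
      then have "exp (\<delta> * norm (g y)) \<le> exp (n * \<delta> * (g y \<bullet> b))"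
        using hle by (simp add: ac_simps)
      then show ?thesis using exp_ge_zero[of "- (n * \<delta> * (g y \<bullet> b))"] by linarith
    next
      case False
      then have "exp (\<delta> * norm (g y)) \<le> exp (- (n * \<delta> * (g y \<bullet> b)))"
        using hle by (simp add: ac_simps)
      then show ?thesis using exp_ge_zero[of "n * \<delta> * (g y \<bullet> b)"] by linarith
    qed
    then have "\<bar>w y\<bar> * exp (\<delta> * norm (g y)) * exp (z \<bullet> g y)
        \<le> \<bar>w y\<bar> * (exp (n * \<delta> * (g y \<bullet> b)) + exp (- (n * \<delta> * (g y \<bullet> b)))) * exp (z \<bullet> g y)"
      by (intro mult_right_mono mult_left_mono) auto
    also have "\<dots> = ?t b"
      by (simp add: abs_mult algebra_simps exp_add exp_diff exp_minus field_simps inner_commute)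
    also have "\<dots> \<le> sum ?t Basis"
      using b(1) by (intro member_le_sum) auto
    finally show ?thesis .
  qed
  ultimately have "integrable M (\<lambda>y. \<bar>w y\<bar> * exp (\<delta> * norm (g y)) * exp (z \<bullet> g y))"
    using g w by (elim Bochner_Integration.integrable_bound) (auto intro!: AE_I2 order_trans[OF _ abs_ge_self])
  with \<delta>(1) show ?thesis by (rule that)
qed

lemma exp_remainder_le: "\<bar>exp r - 1 - r\<bar> \<le> r\<^sup>2 * exp \<bar>r\<bar>" for r :: real
proof -
  obtain t where t: "\<bar>t\<bar> \<le> \<bar>r\<bar>" "exp r = (\<Sum>m<2. r ^ m / fact m) + (exp t / fact 2) * r ^ 2"
    using Maclaurin_exp_le[of r 2] by blast
  have "exp r - 1 - r = (exp t / 2) * r\<^sup>2"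
    using t(2) by (simp add: numeral_2_eq_2)
  then have "\<bar>exp r - 1 - r\<bar> = exp t / 2 * r\<^sup>2" by (simp only: abs_mult) simp
  also have "\<dots> \<le> exp \<bar>r\<bar> * r\<^sup>2"
  proof (rule mult_right_mono)
    have "exp t \<le> exp \<bar>r\<bar>" using t(1) by simp
    moreover have "exp t / 2 \<le> exp t" by simp
    ultimately show "exp t / 2 \<le> exp \<bar>r\<bar>" by linarith
  qed simp
  finally show ?thesis by (simp add: mult.commute)
qed

lemma square_le_exp: "0 \<le> r \<Longrightarrow> r\<^sup>2 \<le> exp (2 * r)" for r :: real
proof -
  assume "0 \<le> r"
  then have "r\<^sup>2 \<le> (exp r)\<^sup>2"
    using exp_ge_add_one_self[of r] by (intro power_mono) linarith+
  then show ?thesis by (simp add: exp_double)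
qed

text \<open>
  By Taylor, \<open>|e\<^sup>r - 1 - r| \<le> r\<^sup>2e\<^bsup>|r|\<^esup>\<close> with \<open>r = h \<cdot> g y\<close>; the margin above absorbs \<open>|g|\<^sup>2e\<^bsup>|h||g|\<^esup>\<close>,
  so the remainder of \<open>F\<close> at \<open>z + h\<close> is at most a constant times \<open>|h|\<^sup>2\<close>.
\<close>

lemma laplace_has_derivative:
  fixes g :: "'a \<Rightarrow> 'v::euclidean_space" and w :: "'a \<Rightarrow> real"
  assumes g[measurable]: "g \<in> borel_measurable M" and w[measurable]: "w \<in> borel_measurable M"
    and S: "open S" and z: "z \<in> S"
    and int: "\<And>z. z \<in> S \<Longrightarrow> integrable M (\<lambda>y. w y * exp (z \<bullet> g y))"
  shows "integrable M (\<lambda>y. w y * (v \<bullet> g y) * exp (z \<bullet> g y))"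
    and "((\<lambda>z. \<integral>y. w y * exp (z \<bullet> g y) \<partial>M) has_derivative
      (\<lambda>v. \<integral>y. w y * (v \<bullet> g y) * exp (z \<bullet> g y) \<partial>M)) (at z)"
proof -
  obtain \<delta> where \<delta>: "0 < \<delta>" "integrable M (\<lambda>y. \<bar>w y\<bar> * exp (\<delta> * norm (g y)) * exp (z \<bullet> g y))" (is "integrable M ?G")
    using laplace_integrable_margin[OF g w S z int] by blast
  show iv: "integrable M (\<lambda>y. w y * (v \<bullet> g y) * exp (z \<bullet> g y))" for v
  proof (rule Bochner_Integration.integrable_bound[OF integrable_mult_right[OF \<delta>(2), of "norm v / \<delta>"]])
    have "norm (w y * (v \<bullet> g y) * exp (z \<bullet> g y)) \<le> norm (norm v / \<delta> * ?G y)" for y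
    proof -
      have "\<bar>v \<bullet> g y\<bar> \<le> norm v * norm (g y)" by (rule Cauchy_Schwarz_ineq2)
      also have "\<dots> = norm v / \<delta> * (\<delta> * norm (g y))" using \<delta>(1) by simp
      also have "\<dots> \<le> norm v / \<delta> * exp (\<delta> * norm (g y))"
      proof (rule mult_left_mono)
        show "\<delta> * norm (g y) \<le> exp (\<delta> * norm (g y))"
          using exp_ge_add_one_self[of "\<delta> * norm (g y)"] by linarith
      qed (use \<delta>(1) in simp)
      finally have "\<bar>w y\<bar> * \<bar>v \<bullet> g y\<bar> * exp (z \<bullet> g y) \<le> \<bar>w y\<bar> * (norm v / \<delta> * exp (\<delta> * norm (g y))) * exp (z \<bullet> g y)"
        by (intro mult_right_mono mult_left_mono) auto
      then show ?thesis using \<delta>(1) by (simp add: abs_mult ac_simps)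
    qed
    then show "AE y in M. norm (w y * (v \<bullet> g y) * exp (z \<bullet> g y)) \<le> norm (norm v / \<delta> * ?G y)" by simp
  qed simp
  define F where "F z = (\<integral>y. w y * exp (z \<bullet> g y) \<partial>M)" for z
  define L where "L v = (\<integral>y. w y * (v \<bullet> g y) * exp (z \<bullet> g y) \<partial>M)" for v
  define C where "C = (\<integral>y. 16 / \<delta>\<^sup>2 * ?G y \<partial>M)"
  obtain e where e: "0 < e" "\<And>z'. dist z' z < e \<Longrightarrow> z' \<in> S"
    using S z by (auto simp: open_dist)
  \<comment> \<open>One half of \<open>exp (\<delta>|g|)\<close> absorbs \<open>exp |h \<bullet> g|\<close>; the other absorbs \<open>|g|\<^sup>2 = (16/\<delta>\<^sup>2)(\<delta>|g|/4)\<^sup>2\<close>, which gives \<open>C\<close>.\<close>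
  have rem: "\<bar>F (z + h) - F z - L h\<bar> \<le> C * (norm h)\<^sup>2" if h: "norm h < e" "norm h \<le> \<delta> / 2" for h
  proof -
    have i: "integrable M (\<lambda>y. w y * exp ((z + h) \<bullet> g y))" "integrable M (\<lambda>y. w y * exp (z \<bullet> g y))"
      using e(2)[of "z + h"] h z int by (auto simp: dist_norm)
    have pt: "\<bar>w y * exp ((z + h) \<bullet> g y) - w y * exp (z \<bullet> g y) - w y * (h \<bullet> g y) * exp (z \<bullet> g y)\<bar>
       \<le> 16 / \<delta>\<^sup>2 * ?G y * (norm h)\<^sup>2" for y
    proof -
      let ?r = "h \<bullet> g y"
      have r: "\<bar>?r\<bar> \<le> norm h * norm (g y)" by (rule Cauchy_Schwarz_ineq2)
      have e1: "exp \<bar>?r\<bar> \<le> exp (\<delta> / 2 * norm (g y))"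
      proof -
        have "norm h * norm (g y) \<le> \<delta> / 2 * norm (g y)"
          using h by (intro mult_right_mono) auto
        then show ?thesis using r by (simp only: exp_le_cancel_iff)
      qed
      have "?r\<^sup>2 \<le> (norm h * norm (g y))\<^sup>2"
        using r by (metis abs_le_square_iff abs_mult abs_norm_cancel)
      also have "\<dots> = 16 / \<delta>\<^sup>2 * (norm h)\<^sup>2 * (\<delta> / 4 * norm (g y))\<^sup>2"
        using \<delta>(1) by (simp add: power_mult_distrib power_divide field_simps)
      also have "\<dots> \<le> 16 / \<delta>\<^sup>2 * (norm h)\<^sup>2 * exp (\<delta> / 2 * norm (g y))"
        using square_le_exp[of "\<delta> / 4 * norm (g y)"] \<delta>(1) by (intro mult_left_mono) auto
      finally have r2: "?r\<^sup>2 \<le> 16 / \<delta>\<^sup>2 * (norm h)\<^sup>2 * exp (\<delta> / 2 * norm (g y))" .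
      have "\<bar>exp ?r - 1 - ?r\<bar> \<le> ?r\<^sup>2 * exp \<bar>?r\<bar>" by (rule exp_remainder_le)
      also have "\<dots> \<le> (16 / \<delta>\<^sup>2 * (norm h)\<^sup>2 * exp (\<delta> / 2 * norm (g y))) * exp (\<delta> / 2 * norm (g y))"
        using r2 e1 by (intro mult_mono) auto
      also have "\<dots> = 16 / \<delta>\<^sup>2 * (norm h)\<^sup>2 * exp (\<delta> * norm (g y))"
        by (simp add: mult.assoc exp_add[symmetric])
      finally have "\<bar>w y\<bar> * exp (z \<bullet> g y) * \<bar>exp ?r - 1 - ?r\<bar>
          \<le> \<bar>w y\<bar> * exp (z \<bullet> g y) * (16 / \<delta>\<^sup>2 * (norm h)\<^sup>2 * exp (\<delta> * norm (g y)))"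
        by (intro mult_left_mono) auto
      moreover have "w y * exp ((z + h) \<bullet> g y) - w y * exp (z \<bullet> g y) - w y * (h \<bullet> g y) * exp (z \<bullet> g y)
          = w y * exp (z \<bullet> g y) * (exp ?r - 1 - ?r)"
        by (simp add: inner_add_left exp_add algebra_simps)
      ultimately show ?thesis by (simp add: abs_mult ac_simps)
    qed
    let ?d = "\<lambda>y. w y * exp ((z + h) \<bullet> g y) - w y * exp (z \<bullet> g y) - w y * (h \<bullet> g y) * exp (z \<bullet> g y)"
    have di: "integrable M ?d"
      by (intro Bochner_Integration.integrable_diff i iv)
    have eq: "F (z + h) - F z - L h = integral\<^sup>L M ?d"
      unfolding F_def L_def
      by (simp only: Bochner_Integration.integral_diff Bochner_Integration.integrable_diff i iv)
    have "\<bar>F (z + h) - F z - L h\<bar> \<le> (\<integral>y. \<bar>?d y\<bar> \<partial>M)"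
      unfolding eq by (rule integral_abs_bound)
    also have "\<dots> \<le> (\<integral>y. 16 / \<delta>\<^sup>2 * ?G y * (norm h)\<^sup>2 \<partial>M)"
    proof (rule integral_mono)
      show "integrable M (\<lambda>y. \<bar>?d y\<bar>)" using di by (rule integrable_abs)
      show "integrable M (\<lambda>y. 16 / \<delta>\<^sup>2 * ?G y * (norm h)\<^sup>2)"
        by (rule integrable_mult_left, rule integrable_mult_right, rule \<delta>(2))
    qed (rule pt)
    also have "\<dots> = C * (norm h)\<^sup>2"
      unfolding C_def by (rule integral_mult_left_zero)
    finally show ?thesis .
  qed
  have C0: "0 \<le> C"
    unfolding C_def by (rule Bochner_Integration.integral_nonneg) auto
  have "bounded_linear L"
  proof (rule linear_conv_bounded_linear[THEN iffD1], rule linearI)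
    show "L (a + b) = L a + L b" for a b
    proof -
      have "L (a + b) = (\<integral>y. w y * (a \<bullet> g y) * exp (z \<bullet> g y) + w y * (b \<bullet> g y) * exp (z \<bullet> g y) \<partial>M)"
        unfolding L_def by (simp only: inner_add_left distrib_left distrib_right)
      then show ?thesis
        unfolding L_def by (simp only: Bochner_Integration.integral_add iv)
    qed
    show "L (c *\<^sub>R a) = c *\<^sub>R L a" for c a
    proof -
      have "L (c *\<^sub>R a) = (\<integral>y. c * (w y * (a \<bullet> g y) * exp (z \<bullet> g y)) \<partial>M)"
        unfolding L_def by (intro Bochner_Integration.integral_cong) auto
      then show ?thesis by (simp add: L_def)
    qed
  qed
  moreover have "((\<lambda>h. norm (F (z + h) - F z - L h) / norm h) \<longlongrightarrow> 0) (at 0)"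
  proof (rule Lim_null_comparison)
    have "eventually (\<lambda>h. dist h 0 < min e (\<delta> / 2)) (at (0::'v))"
      using e(1) \<delta>(1) by (auto simp: eventually_at intro: exI[of _ "min e (\<delta> / 2)"])
    then show "eventually (\<lambda>h. norm (norm (F (z + h) - F z - L h) / norm h) \<le> C * norm h) (at 0)"
    proof eventually_elim
      case (elim h)
      then have "\<bar>F (z + h) - F z - L h\<bar> \<le> C * (norm h)\<^sup>2" using rem by simp
      then show ?case using C0
        by (cases "h = 0") (auto simp: divide_le_eq power2_eq_square mult.assoc)
    qed
    show "((\<lambda>h. C * norm h) \<longlongrightarrow> 0) (at (0::'v))"
      by (auto intro!: tendsto_eq_intros)
  qed
  ultimately have "(F has_derivative L) (at z)"
    by (simp add: has_derivative_at)
  then show "((\<lambda>z. \<integral>y. w y * exp (z \<bullet> g y) \<partial>M) has_derivative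
      (\<lambda>v. \<integral>y. w y * (v \<bullet> g y) * exp (z \<bullet> g y) \<partial>M)) (at z)"
    by (simp add: F_def[abs_def] L_def[abs_def])
qed

text \<open>
  A directional derivative of the transform with weight \<open>w\<close> is the transform with weight
  \<open>w \<cdot> \<langle>v, g\<rangle>\<close>, convergent on the same open set.
\<close>

lemma laplace_Ck_on:
  fixes g :: "'a \<Rightarrow> 'v::euclidean_space" and w :: "'a \<Rightarrow> real"
  assumes g: "g \<in> borel_measurable M" and S: "open S"
    and "w \<in> borel_measurable M"
    and "\<And>z. z \<in> S \<Longrightarrow> integrable M (\<lambda>y. w y * exp (z \<bullet> g y))"
  shows "Ck_on k (\<lambda>z. \<integral>y. w y * exp (z \<bullet> g y) \<partial>M) S"
  using assms(3,4)
proof (induction k arbitrary: w)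
  case 0
  have "isCont (\<lambda>z. \<integral>y. w y * exp (z \<bullet> g y) \<partial>M) z" if "z \<in> S" for z
    using laplace_has_derivative(2)[OF g 0(1) S that 0(2)] by (rule has_derivative_continuous)
  then show ?case by (auto intro: continuous_at_imp_continuous_on)
next
  case (Suc k)
  note d = laplace_has_derivative[OF g Suc.prems(1) S _ Suc.prems(2)]
  show ?case
  proof (rule Ck_on_SucI[OF S d(2)])
    show "Ck_on k (\<lambda>z. \<integral>y. w y * (v \<bullet> g y) * exp (z \<bullet> g y) \<partial>M) S" for v
      using g Suc.prems(1) by (intro Suc.IH d(1)) auto
  qed
qed

section \<open>The heat potential of a measure of Gaussian growth\<close>

text \<open>
  The difference of the exponents is a perfect square:
  \<open>s|x - y|\<^sup>2 - \<epsilon>|y|\<^sup>2 + (\<epsilon>s/(s - \<epsilon>))|x|\<^sup>2 = |(s - \<epsilon>)y - sx|\<^sup>2 / (s - \<epsilon>)\<close>.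
\<close>

lemma gaussian_shift_bound:
  fixes x y :: "'a::real_inner"
  assumes "\<epsilon> < s"
  shows "exp (- s * (norm (x - y))\<^sup>2)
    \<le> exp (\<epsilon> * s / (s - \<epsilon>) * (norm x)\<^sup>2) * exp (- \<epsilon> * (norm y)\<^sup>2)"
proof -
  have "0 \<le> (norm ((s - \<epsilon>) *\<^sub>R y - s *\<^sub>R x))\<^sup>2 / (s - \<epsilon>)" using assms by simp
  also have "\<dots> = ((s - \<epsilon>)\<^sup>2 * (y \<bullet> y) - 2 * (s - \<epsilon>) * s * (x \<bullet> y) + s\<^sup>2 * (x \<bullet> x)) / (s - \<epsilon>)"
    unfolding power2_norm_eq_inner
    by (simp add: inner_diff_left inner_diff_right inner_commute power2_eq_square algebra_simps)
  also have "\<dots> = s * (norm (x - y))\<^sup>2 - \<epsilon> * (norm y)\<^sup>2 + \<epsilon> * s / (s - \<epsilon>) * (norm x)\<^sup>2"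
    unfolding power2_norm_eq_inner using assms
    by (simp add: inner_diff_left inner_diff_right inner_commute power2_eq_square divide_simps) (simp add: algebra_simps)
  finally show ?thesis unfolding exp_add[symmetric] by simp
qed

text \<open>\<open>M\<close> is the total variation and \<open>h\<close> the sign of the signed measure \<open>h M\<close>, the initial datum.\<close>

locale gaussian_growth =
  fixes M :: "'a::euclidean_space measure" and h :: "'a \<Rightarrow> real" and \<epsilon> :: real
  assumes radon: "radon_measure M"
    and h_measurable: "h \<in> borel_measurable borel"
    and abs_h: "\<bar>h y\<bar> = 1"
    and \<epsilon>_pos: "0 < \<epsilon>"
    and integrable_gaussian: "integrable M (\<lambda>y. exp (- \<epsilon> * (norm y)\<^sup>2))"
begin

lemma sets_M[measurable_cong]: "sets M = sets borel"
  using radon by (simp add: radon_measure_def)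

declare h_measurable[measurable]

lemma integrable_kernel:
  assumes "\<epsilon> < s"
  shows "integrable M (\<lambda>y. exp (- s * (norm (x - y))\<^sup>2))"
proof (rule Bochner_Integration.integrable_bound)
  show "integrable M (\<lambda>y. exp (\<epsilon> * s / (s - \<epsilon>) * (norm x)\<^sup>2) * exp (- \<epsilon> * (norm y)\<^sup>2))"
    by (rule integrable_mult_right[OF integrable_gaussian])
  show "AE y in M. norm (exp (- s * (norm (x - y))\<^sup>2))
      \<le> norm (exp (\<epsilon> * s / (s - \<epsilon>) * (norm x)\<^sup>2) * exp (- \<epsilon> * (norm y)\<^sup>2))"
    unfolding real_norm_def abs_exp_cancel
    by (rule AE_I2) (rule order_trans[OF gaussian_shift_bound[OF assms] abs_ge_self])
qed measurable

lemma integrable_h: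
  assumes "integrable M f"
  shows "integrable M (\<lambda>y. h y * f y)"
  by (rule Bochner_Integration.integrable_bound[OF assms]) (use assms in \<open>auto simp: abs_mult abs_h\<close>)

text \<open>
  Completing the square turns the Gaussian kernel into a Laplace kernel: with
  \<open>g y = (y, - |y|\<^sup>2)\<close> and \<open>z = (x/2t, 1/4t)\<close>,
  \<open>- |x - y|\<^sup>2/4t = - |x|\<^sup>2/4t + z \<bullet> g y\<close>. The transform converges on the half space
  where the second coordinate exceeds \<open>\<epsilon>\<close>.
\<close>

definition g :: "'a \<Rightarrow> 'a \<times> real" where
  "g y = (y, - (norm y)\<^sup>2)"

definition halfspace :: "('a \<times> real) set" where
  "halfspace = UNIV \<times> {\<epsilon><..}"

definition transform :: "('a \<Rightarrow> real) \<Rightarrow> 'a \<times> real \<Rightarrow> real" where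
  "transform w z = (\<integral>y. w y * exp (z \<bullet> g y) \<partial>M)"

lemma g_measurable[measurable]: "g \<in> borel_measurable borel"
  unfolding g_def[abs_def] by (intro borel_measurable_continuous_onI continuous_intros)

lemma open_halfspace: "open halfspace"
  by (auto simp: halfspace_def intro: open_Times)

definition admissible :: "('a \<Rightarrow> real) \<Rightarrow> bool" where
  "admissible w \<longleftrightarrow> w \<in> borel_measurable borel \<and>
    (\<forall>z\<in>halfspace. integrable M (\<lambda>y. w y * exp (z \<bullet> g y)))"

lemma heat_exponent:
  assumes "0 < t"
  shows "- (norm (x - y))\<^sup>2 / (4 * t) = - (norm x)\<^sup>2 / (4 * t) + (x /\<^sub>R (2 * t), 1 / (4 * t)) \<bullet> g y"
  unfolding power2_norm_eq_inner g_def using assms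
  by (simp add: inner_diff_left inner_diff_right inner_commute field_simps)

lemma admissible_h: "admissible h"
  unfolding admissible_def
proof (intro conjI ballI h_measurable)
  fix z assume "z \<in> halfspace"
  then obtain \<xi> s where z: "z = (\<xi>, s)" "\<epsilon> < s" by (auto simp: halfspace_def)
  have "s > 0" using z \<epsilon>_pos by simp
  define t where "t = 1 / (4 * s)"
  have t: "0 < t" "1 / (4 * t) = s" using \<open>s > 0\<close> by (auto simp: t_def)
  define x where "x = (2 * t) *\<^sub>R \<xi>"
  have "exp (z \<bullet> g y) = exp ((norm x)\<^sup>2 / (4 * t)) * exp (- s * (norm (x - y))\<^sup>2)" for y
  proof -
    have "z = (x /\<^sub>R (2 * t), 1 / (4 * t))" using t by (simp add: x_def z(1))
    then have "z \<bullet> g y = (norm x)\<^sup>2 / (4 * t) + - (norm (x - y))\<^sup>2 / (4 * t)"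
      using heat_exponent[OF t(1), of x y] by simp
    also have "- (norm (x - y))\<^sup>2 / (4 * t) = - s * (norm (x - y))\<^sup>2"
      unfolding t(2)[symmetric] by simp
    finally show ?thesis unfolding exp_add[symmetric] by simp
  qed
  then show "integrable M (\<lambda>y. h y * exp (z \<bullet> g y))"
    using integrable_kernel[OF z(2), of x] by (intro integrable_h) simp
qed

lemma admissible_measurable:
  assumes "admissible w"
  shows "w \<in> borel_measurable M"
proof -
  have [measurable]: "w \<in> borel_measurable borel" using assms by (simp add: admissible_def)
  show ?thesis by measurable
qed

lemma g_measurable_M: "g \<in> borel_measurable M"
  by measurable

lemma admissible_integrable: "admissible w \<Longrightarrow> z \<in> halfspace \<Longrightarrow> integrable M (\<lambda>y. w y * exp (z \<bullet> g y))"
  unfolding admissible_def by blast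

lemma transform_has_derivative:
  assumes w: "admissible w" and z: "z \<in> halfspace"
  shows "(transform w has_derivative (\<lambda>v. transform (\<lambda>y. w y * (v \<bullet> g y)) z)) (at z)"
  unfolding transform_def[abs_def]
  by (rule laplace_has_derivative(2)[OF g_measurable_M admissible_measurable[OF w] open_halfspace z])
    (rule admissible_integrable[OF w])

lemma admissible_mult:
  assumes w: "admissible w"
  shows "admissible (\<lambda>y. w y * (v \<bullet> g y))"
  unfolding admissible_def
proof (intro conjI ballI)
  show "(\<lambda>y. w y * (v \<bullet> g y)) \<in> borel_measurable borel"
  proof -
    have [measurable]: "w \<in> borel_measurable borel" using w by (simp add: admissible_def)
    show ?thesis by measurable
  qed
  show "integrable M (\<lambda>y. w y * (v \<bullet> g y) * exp (z \<bullet> g y))" if "z \<in> halfspace" for z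
    by (rule laplace_has_derivative(1)[OF g_measurable_M admissible_measurable[OF w] open_halfspace that])
      (rule admissible_integrable[OF w])
qed

lemma admissible_component: "admissible w \<Longrightarrow> admissible (\<lambda>y. w y * (y \<bullet> b))"
  using admissible_mult[of w "(b, 0)"] by (simp add: g_def inner_commute)

lemma transform_Ck_on: "admissible w \<Longrightarrow> Ck_on k (transform w) halfspace"
  unfolding transform_def[abs_def]
  by (rule laplace_Ck_on[OF g_measurable_M open_halfspace admissible_measurable admissible_integrable])

definition potential :: "'a \<Rightarrow> real \<Rightarrow> real" where
  "potential x t = 1 / (4 * pi * t) powr (real DIM('a) / 2)
     * (\<integral>y. h y * exp (- (norm (x - y))\<^sup>2 / (4 * t)) \<partial>M)"

definition \<zeta> :: "'a \<Rightarrow> real \<Rightarrow> 'a \<times> real" where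
  "\<zeta> x t = (x /\<^sub>R (2 * t), 1 / (4 * t))"

lemma \<zeta>_halfspace: "0 < t \<Longrightarrow> t < 1 / (4 * \<epsilon>) \<Longrightarrow> \<zeta> x t \<in> halfspace"
  using \<epsilon>_pos by (auto simp: \<zeta>_def halfspace_def field_simps)

lemma potential_eq_transform:
  assumes "0 < t"
  shows "potential x t = (4 * pi * t) powr (- (real DIM('a) / 2))
    * (exp (- (norm x)\<^sup>2 / (4 * t)) * transform h (\<zeta> x t))"
proof -
  have e: "h y * exp (- (norm (x - y))\<^sup>2 / (4 * t))
      = exp (- (norm x)\<^sup>2 / (4 * t)) * (h y * exp (\<zeta> x t \<bullet> g y))" for y
    unfolding heat_exponent[OF assms, of x y] exp_add \<zeta>_def by (rule mult.left_commute)
  have "(\<integral>y. h y * exp (- (norm (x - y))\<^sup>2 / (4 * t)) \<partial>M)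
      = exp (- (norm x)\<^sup>2 / (4 * t)) * transform h (\<zeta> x t)"
    unfolding e transform_def by (rule integral_mult_right_zero)
  then show ?thesis
    unfolding potential_def powr_minus_divide by (rule arg_cong)
qed

text \<open>
  The factors are composed from linear maps, \<open>exp\<close>, powers and the Laplace transform. Writing \<open>1/t\<close> as a power
  \<open>t powr - 1\<close> keeps the list of elementary functions short.
\<close>

lemma potential_Cinf_on: "Cinf_on (\<lambda>(x, t). potential x t) (UNIV \<times> {0<..<1 / (4 * \<epsilon>)})"
  unfolding Cinf_on_def
proof
  fix k
  let ?S = "(UNIV :: 'a set) \<times> {0<..<1 / (4 * \<epsilon>)}"
  have S: "open ?S" by (intro open_Times) auto
  have t: "Ck_on k (\<lambda>p. snd p) ?S"
    by (intro Ck_on_linear S bounded_linear_snd)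
  have x: "Ck_on k (\<lambda>p. fst p \<bullet> b) ?S" for b
    by (intro Ck_on_linear S bounded_linear_inner_left_comp bounded_linear_fst)
  have inv: "Ck_on k (\<lambda>p. snd p powr - 1) ?S"
    by (rule Ck_on_compose[OF S _ _ Ck_on_powr]) (use t in auto)
  have c: "Ck_on k (\<lambda>p. (4 * pi * snd p) powr (- (real DIM('a) / 2))) ?S"
    by (rule Ck_on_compose[OF S _ _ Ck_on_powr]) (use Ck_on_mult[OF S Ck_on_const t] in auto)
  have e: "Ck_on k (\<lambda>p. exp (- 1 / 4 * ((\<Sum>b\<in>Basis. (fst p \<bullet> b) * (fst p \<bullet> b)) * snd p powr - 1))) ?S"
  proof (rule Ck_on_compose[OF S open_UNIV _ Ck_on_exp])
    show "Ck_on k (\<lambda>p. (- 1 / 4 * ((\<Sum>b\<in>Basis. (fst p \<bullet> b) * (fst p \<bullet> b)) * snd p powr - 1)) \<bullet> c) ?S"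
      if "c \<in> Basis" for c :: real
    proof -
      have "Ck_on k (\<lambda>p. - 1 / 4 * ((\<Sum>b\<in>Basis. (fst p \<bullet> b) * (fst p \<bullet> b)) * snd p powr - 1)) ?S"
        by (rule Ck_on_mult[OF S Ck_on_const Ck_on_mult[OF S Ck_on_sum[OF S Ck_on_mult[OF S x x]] inv]])
      then show ?thesis using that by simp
    qed
  qed simp
  have F: "Ck_on k (\<lambda>p. transform h ((1 / 2 * snd p powr - 1) *\<^sub>R fst p, 1 / 4 * snd p powr - 1)) ?S"
  proof (rule Ck_on_compose[OF S open_halfspace _ transform_Ck_on[OF admissible_h]])
    show "((1 / 2 * snd p powr - 1) *\<^sub>R fst p, 1 / 4 * snd p powr - 1) \<in> halfspace" if "p \<in> ?S" for p
      using \<zeta>_halfspace[of "snd p" "fst p"] that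
      by (auto simp: \<zeta>_def powr_minus halfspace_def field_simps)
    fix c :: "'a \<times> real" assume "c \<in> Basis"
    then consider b where "c = (b, 0)" | "c = (0, 1)" by (auto simp: Basis_prod_def)
    then show "Ck_on k (\<lambda>p. ((1 / 2 * snd p powr - 1) *\<^sub>R fst p, 1 / 4 * snd p powr - 1) \<bullet> c) ?S"
    proof cases
      case 1
      then show ?thesis
        using Ck_on_mult[OF S Ck_on_mult[OF S Ck_on_const[of _ "1/2"] inv] x] by simp
    next
      case 2
      then show ?thesis
        using Ck_on_mult[OF S Ck_on_const[of _ "1/4"] inv] by simp
    qed
  qed
  show "Ck_on k (\<lambda>(x, t). potential x t) ?S"
  proof (rule Ck_on_cong[OF S Ck_on_mult[OF S c Ck_on_mult[OF S e F]]], clarify)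
    fix x :: 'a and t :: real assume t: "t \<in> {0<..<1 / (4 * \<epsilon>)}"
    have "(\<Sum>b\<in>Basis. (x \<bullet> b) * (x \<bullet> b)) = (norm x)\<^sup>2"
      by (simp add: power2_norm_eq_inner euclidean_inner[of x x])
    moreover have "\<zeta> x t = ((1 / 2 * t powr - 1) *\<^sub>R x, 1 / 4 * t powr - 1)"
      using t by (auto simp: \<zeta>_def powr_minus field_simps)
    ultimately show "(4 * pi * snd (x, t)) powr (- (real DIM('a) / 2)) *
        (exp (- 1 / 4 * ((\<Sum>b\<in>Basis. (fst (x, t) \<bullet> b) * (fst (x, t) \<bullet> b)) * snd (x, t) powr - 1)) *
         transform h ((1 / 2 * snd (x, t) powr - 1) *\<^sub>R fst (x, t), 1 / 4 * snd (x, t) powr - 1)) =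
        potential x t"
      using t by (simp add: potential_eq_transform powr_minus field_simps)
  qed
qed

lemma transform_line_DERIV:
  assumes w: "admissible w" and t: "0 < t" "t < 1 / (4 * \<epsilon>)"
  shows "((\<lambda>r. transform w (\<zeta> (x + r *\<^sub>R b) t)) has_real_derivative
    transform (\<lambda>y. w y * (y \<bullet> b)) (\<zeta> (x + r *\<^sub>R b) t) / (2 * t)) (at r)"
proof -
  have z: "((\<lambda>r. \<zeta> (x + r *\<^sub>R b) t) has_derivative (\<lambda>s. (s *\<^sub>R b /\<^sub>R (2 * t), 0))) (at r)"
    unfolding \<zeta>_def by (auto intro!: derivative_eq_intros)
  have L: "(\<lambda>s. transform (\<lambda>y. w y * ((s *\<^sub>R b /\<^sub>R (2 * t), 0) \<bullet> g y)) z)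
      = (*) (transform (\<lambda>y. w y * (y \<bullet> b)) z / (2 * t))" for z
  proof
    fix s
    have "transform (\<lambda>y. w y * ((s *\<^sub>R b /\<^sub>R (2 * t), 0) \<bullet> g y)) z
        = (\<integral>y. s / (2 * t) * (w y * (y \<bullet> b) * exp (z \<bullet> g y)) \<partial>M)"
      unfolding transform_def by (intro Bochner_Integration.integral_cong)
        (auto simp: g_def inner_commute field_simps)
    then show "transform (\<lambda>y. w y * ((s *\<^sub>R b /\<^sub>R (2 * t), 0) \<bullet> g y)) z
        = transform (\<lambda>y. w y * (y \<bullet> b)) z / (2 * t) * s"
      by (simp add: transform_def)
  qed
  show ?thesis
    using has_derivative_compose[OF z transform_has_derivative[OF w \<zeta>_halfspace[OF t]]]
    unfolding has_field_derivative_def L .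
qed

lemma transform_add:
  assumes "admissible v" "admissible w" "z \<in> halfspace"
  shows "transform (\<lambda>y. v y + w y) z = transform v z + transform w z"
  using assms by (simp add: transform_def admissible_def distrib_right)

lemma admissible_add: "admissible v \<Longrightarrow> admissible w \<Longrightarrow> admissible (\<lambda>y. v y + w y)"
  by (auto simp: admissible_def distrib_right)

lemma transform_cmult: "transform (\<lambda>y. c * w y) z = c * transform w z"
  by (simp add: transform_def mult.assoc)

lemma transform_sum:
  assumes "\<And>i. i \<in> I \<Longrightarrow> admissible (w i)" "z \<in> halfspace"
  shows "transform (\<lambda>y. \<Sum>i\<in>I. w i y) z = (\<Sum>i\<in>I. transform (w i) z)"
  unfolding transform_def sum_distrib_right
  using assms by (intro Bochner_Integration.integral_sum) (auto simp: admissible_def)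

lemma transform_curve_DERIV:
  assumes t: "0 < t" "t < 1 / (4 * \<epsilon>)"
  shows "((\<lambda>t. transform h (\<zeta> x t)) has_real_derivative
    (\<Sum>b\<in>Basis. transform (\<lambda>y. h y * (y \<bullet> b) * (y \<bullet> b)) (\<zeta> x t)) / (4 * t\<^sup>2)
    - (\<Sum>b\<in>Basis. (x \<bullet> b) * transform (\<lambda>y. h y * (y \<bullet> b)) (\<zeta> x t)) / (2 * t\<^sup>2)) (at t)"
proof -
  let ?z = "\<zeta> x t"
  let ?v = "\<lambda>s. (- (s / (2 * t\<^sup>2)) *\<^sub>R x, - s / (4 * t\<^sup>2))"
  have z: "((\<lambda>t. \<zeta> x t) has_derivative ?v) (at t)"
    unfolding \<zeta>_def using t
    by (auto intro!: derivative_eq_intros simp: power2_eq_square field_simps)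
  have adm: "admissible (\<lambda>y. h y * (y \<bullet> b))" "admissible (\<lambda>y. h y * (y \<bullet> b) * (y \<bullet> b))" for b
    by (intro admissible_component admissible_h)+
  have adm_cmult: "admissible w \<Longrightarrow> admissible (\<lambda>y. c * w y)" for c w
    by (auto simp: admissible_def mult.assoc)
  have L: "(\<lambda>s. transform (\<lambda>y. h y * (?v s \<bullet> g y)) ?z) = (*)
    ((\<Sum>b\<in>Basis. transform (\<lambda>y. h y * (y \<bullet> b) * (y \<bullet> b)) ?z) / (4 * t\<^sup>2)
    - (\<Sum>b\<in>Basis. (x \<bullet> b) * transform (\<lambda>y. h y * (y \<bullet> b)) ?z) / (2 * t\<^sup>2))"
  proof
    fix s
    have ar: "s / (4 * t\<^sup>2) * p + - (s / (2 * t\<^sup>2)) * q = (p / (4 * t\<^sup>2) - q / (2 * t\<^sup>2)) * s" for p q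
      by (simp add: algebra_simps)
    have pt: "h y * (?v s \<bullet> g y) = (\<Sum>b\<in>Basis. s / (4 * t\<^sup>2) * (h y * (y \<bullet> b) * (y \<bullet> b))
        + - (s / (2 * t\<^sup>2)) * (x \<bullet> b) * (h y * (y \<bullet> b)))" for y
    proof -
      have "h y * (?v s \<bullet> g y) = s / (4 * t\<^sup>2) * h y * (y \<bullet> y) - s / (2 * t\<^sup>2) * h y * (x \<bullet> y)"
        unfolding g_def power2_norm_eq_inner by (simp add: algebra_simps)
      also have "\<dots> = s / (4 * t\<^sup>2) * h y * (\<Sum>b\<in>Basis. (y \<bullet> b) * (y \<bullet> b))
          - s / (2 * t\<^sup>2) * h y * (\<Sum>b\<in>Basis. (x \<bullet> b) * (y \<bullet> b))"
        by (simp only: euclidean_inner[of y y] euclidean_inner[of x y])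
      also have "\<dots> = (\<Sum>b\<in>Basis. s / (4 * t\<^sup>2) * h y * ((y \<bullet> b) * (y \<bullet> b))
          - s / (2 * t\<^sup>2) * h y * ((x \<bullet> b) * (y \<bullet> b)))"
        by (simp only: sum_distrib_left sum_subtractf)
      finally show ?thesis by (simp add: mult_ac)
    qed
    have "transform (\<lambda>y. h y * (?v s \<bullet> g y)) ?z =
       (\<Sum>b\<in>Basis. s / (4 * t\<^sup>2) * transform (\<lambda>y. h y * (y \<bullet> b) * (y \<bullet> b)) ?z
         + - (s / (2 * t\<^sup>2)) * (x \<bullet> b) * transform (\<lambda>y. h y * (y \<bullet> b)) ?z)"
      unfolding pt using \<zeta>_halfspace[OF t, of x]
      by (simp only: transform_sum transform_add transform_cmult adm_cmult adm admissible_add)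
    also have "\<dots> = s / (4 * t\<^sup>2) * (\<Sum>b\<in>Basis. transform (\<lambda>y. h y * (y \<bullet> b) * (y \<bullet> b)) ?z)
         + - (s / (2 * t\<^sup>2)) * (\<Sum>b\<in>Basis. (x \<bullet> b) * transform (\<lambda>y. h y * (y \<bullet> b)) ?z)"
      by (simp only: sum.distrib sum_distrib_left mult.assoc)
    finally show "transform (\<lambda>y. h y * (?v s \<bullet> g y)) ?z =
      ((\<Sum>b\<in>Basis. transform (\<lambda>y. h y * (y \<bullet> b) * (y \<bullet> b)) ?z) / (4 * t\<^sup>2)
      - (\<Sum>b\<in>Basis. (x \<bullet> b) * transform (\<lambda>y. h y * (y \<bullet> b)) ?z) / (2 * t\<^sup>2)) * s"
      unfolding ar .
  qed
  show ?thesis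
    using has_derivative_compose[OF z transform_has_derivative[OF admissible_h \<zeta>_halfspace[OF t]]]
    unfolding has_field_derivative_def L .
qed

text \<open>
  With \<open>A\<close>, \<open>B\<^sub>b\<close>, \<open>C\<^sub>b\<close> the transforms of \<open>h\<close>, \<open>h y\<^sub>b\<close>, \<open>h y\<^sub>b\<^sup>2\<close> at \<open>\<zeta> x t\<close>, both \<open>u\<^sub>t\<close> and \<open>\<Delta>u\<close> equal the
  prefactor times \<open>|x|\<^sup>2A/4t\<^sup>2 - dA/2t - \<Sum>\<^sub>b x\<^sub>bB\<^sub>b/2t\<^sup>2 + \<Sum>\<^sub>b C\<^sub>b/4t\<^sup>2\<close>.
\<close>

proposition potential_heat_equation:
  assumes t: "0 < t" "t < 1 / (4 * \<epsilon>)"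
  shows "deriv (\<lambda>s. potential x s) t = laplacian (\<lambda>y. potential y t) x"
proof -
  define c where "c s = (4 * pi * s) powr (- (real DIM('a) / 2))" for s
  define E where "E x = exp (- (norm x)\<^sup>2 / (4 * t))" for x :: 'a
  define A where "A x = transform h (\<zeta> x t)" for x
  define B where "B b x = transform (\<lambda>y. h y * (y \<bullet> b)) (\<zeta> x t)" for b x
  define C where "C b x = transform (\<lambda>y. h y * (y \<bullet> b) * (y \<bullet> b)) (\<zeta> x t)" for b x
  define K where "K = (norm x)\<^sup>2 / (4 * t\<^sup>2) * A x - real DIM('a) / (2 * t) * A x
      - (\<Sum>b\<in>Basis. (x \<bullet> b) * B b x) / (2 * t\<^sup>2) + (\<Sum>b\<in>Basis. C b x) / (4 * t\<^sup>2)"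
  have time: "deriv (\<lambda>s. potential x s) t = c t * E x * K"
  proof (rule DERIV_imp_deriv)
    have dc: "(c has_real_derivative - (real DIM('a) / (2 * t)) * c t) (at t)"
    proof -
      have q: "0 < 4 * pi * t" using t(1) by simp
      have "((\<lambda>s. 4 * pi * s) has_real_derivative 4 * pi) (at t)"
        by (auto intro!: derivative_eq_intros)
      from DERIV_fun_powr[OF this q, of "- (real DIM('a) / 2)"]
      have "(c has_real_derivative - (real DIM('a) / 2) * (4 * pi * t) powr (- (real DIM('a) / 2) - 1) * (4 * pi)) (at t)"
        by (simp add: c_def[abs_def])
      also have "(4 * pi * t) powr (- (real DIM('a) / 2) - 1) = c t / (4 * pi * t)"
        unfolding c_def powr_diff using q by simp
      also have "- (real DIM('a) / 2) * (c t / (4 * pi * t)) * (4 * pi) = - (real DIM('a) / (2 * t)) * c t"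
        using t(1) by simp
      finally show ?thesis .
    qed
    have dE: "((\<lambda>s. exp (- (norm x)\<^sup>2 / (4 * s))) has_real_derivative (norm x)\<^sup>2 / (4 * t\<^sup>2) * E x) (at t)"
      unfolding E_def using t(1) by (auto intro!: derivative_eq_intros simp: power2_eq_square field_simps)
    have "((\<lambda>s. c s * (exp (- (norm x)\<^sup>2 / (4 * s)) * transform h (\<zeta> x s))) has_real_derivative c t * E x * K) (at t)"
      by (rule DERIV_cong[OF DERIV_mult[OF dc DERIV_mult[OF dE transform_curve_DERIV[OF t, of x]]]])
        (simp add: K_def A_def B_def C_def E_def algebra_simps)
    then show "((\<lambda>s. potential x s) has_real_derivative c t * E x * K) (at t)"
      by (rule has_field_derivative_transform_within_open[where S="{0<..}"]) (use t(1) in \<open>auto simp: potential_eq_transform c_def\<close>)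
  qed
  have space: "deriv (deriv (\<lambda>s. potential (x + s *\<^sub>R b) t)) 0
      = c t * E x * ((x \<bullet> b)\<^sup>2 / (4 * t\<^sup>2) * A x - A x / (2 * t) - (x \<bullet> b) * B b x / (2 * t\<^sup>2) + C b x / (4 * t\<^sup>2))"
    if b: "b \<in> Basis" for b
  proof -
    have dE: "((\<lambda>r. E (x + r *\<^sub>R b)) has_real_derivative - ((x \<bullet> b + r) / (2 * t)) * E (x + r *\<^sub>R b)) (at r)" for r
    proof -
      have n: "(norm (x + r *\<^sub>R b))\<^sup>2 = (norm x)\<^sup>2 + 2 * r * (x \<bullet> b) + r\<^sup>2" for r
        using b unfolding power2_norm_eq_inner
        by (simp add: inner_add_left inner_add_right inner_commute power2_eq_square)
      show ?thesis
        unfolding E_def n using t(1)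
        by (auto intro!: derivative_eq_intros simp: field_simps)
    qed
    have dA: "((\<lambda>r. A (x + r *\<^sub>R b)) has_real_derivative B b (x + r *\<^sub>R b) / (2 * t)) (at r)" for r
      unfolding A_def B_def by (rule transform_line_DERIV[OF admissible_h t])
    have dB: "((\<lambda>r. B b (x + r *\<^sub>R b)) has_real_derivative C b (x + r *\<^sub>R b) / (2 * t)) (at r)" for r
      unfolding B_def C_def by (rule transform_line_DERIV[OF admissible_component[OF admissible_h] t])
    have "deriv (\<lambda>s. potential (x + s *\<^sub>R b) t) = (\<lambda>r. c t * (E (x + r *\<^sub>R b) *
        (B b (x + r *\<^sub>R b) / (2 * t) - (x \<bullet> b + r) / (2 * t) * A (x + r *\<^sub>R b))))"
    proof (rule ext, rule DERIV_imp_deriv)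
      fix r
      have eq: "(\<lambda>s. potential (x + s *\<^sub>R b) t) = (\<lambda>s. c t * (E (x + s *\<^sub>R b) * A (x + s *\<^sub>R b)))"
        by (simp add: potential_eq_transform[OF t(1)] c_def E_def A_def)
      show "((\<lambda>s. potential (x + s *\<^sub>R b) t) has_real_derivative c t * (E (x + r *\<^sub>R b) *
        (B b (x + r *\<^sub>R b) / (2 * t) - (x \<bullet> b + r) / (2 * t) * A (x + r *\<^sub>R b)))) (at r)"
        unfolding eq
        by (rule DERIV_cong[OF DERIV_cmult[OF DERIV_mult[OF dE dA]]]) (simp add: algebra_simps)
    qed
    moreover have "((\<lambda>r. c t * (E (x + r *\<^sub>R b) *
        (B b (x + r *\<^sub>R b) / (2 * t) - (x \<bullet> b + r) / (2 * t) * A (x + r *\<^sub>R b)))) has_real_derivative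
        c t * E x * ((x \<bullet> b)\<^sup>2 / (4 * t\<^sup>2) * A x - A x / (2 * t) - (x \<bullet> b) * B b x / (2 * t\<^sup>2) + C b x / (4 * t\<^sup>2))) (at 0)"
    proof -
      have dx: "((\<lambda>r. (x \<bullet> b + r) / (2 * t)) has_real_derivative 1 / (2 * t)) (at 0)"
        using t(1) by (auto intro!: derivative_eq_intros)
      show ?thesis
        by (rule DERIV_cong[OF DERIV_cmult[OF DERIV_mult[OF dE DERIV_diff[OF DERIV_cdivide[OF dB] DERIV_mult[OF dx dA]]]]])
          (use t(1) in \<open>simp add: power2_eq_square field_simps\<close>)
    qed
    ultimately show ?thesis by (simp add: DERIV_imp_deriv)
  qed
  have nx: "(\<Sum>b\<in>Basis. (x \<bullet> b)\<^sup>2) = (norm x)\<^sup>2"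
    unfolding power2_norm_eq_inner euclidean_inner[of x x] by (simp only: power2_eq_square)
  have "laplacian (\<lambda>y. potential y t) x = (\<Sum>b\<in>Basis. c t * E x *
      ((x \<bullet> b)\<^sup>2 / (4 * t\<^sup>2) * A x - A x / (2 * t) - (x \<bullet> b) * B b x / (2 * t\<^sup>2) + C b x / (4 * t\<^sup>2)))"
    unfolding laplacian_def by (rule sum.cong[OF refl space])
  also have "\<dots> = c t * E x * K"
    unfolding K_def nx[symmetric]
    by (simp only: sum_distrib_left[symmetric] sum.distrib sum_subtractf sum_divide_distrib[symmetric]
        sum_distrib_right[symmetric] sum_constant) simp
  finally show ?thesis using time by simp
qed

end

section \<open>The heat semigroup on test functions\<close>

text \<open>The heat kernel at time \<open>t\<close> is a product of one-dimensional normal densities of variance \<open>2t\<close>.\<close>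

lemma has_bochner_integral_gaussian:
  fixes a :: "'a::euclidean_space"
  assumes t: "0 < t"
  shows "has_bochner_integral lborel (\<lambda>x. exp (- (norm (x - a))\<^sup>2 / (4 * t)))
    ((4 * pi * t) powr (real DIM('a) / 2))"
proof -
  define q where "q = (4 * pi * t) powr (real DIM('a) / 2)"
  have q: "0 < q" using t by (simp add: q_def)
  let ?e = "\<lambda>x::'a. exp (- (norm (x - a))\<^sup>2 / (4 * t))"
  have nd: "normal_density m (sqrt (2 * t)) r = 1 / sqrt (4 * pi * t) * exp (- (r - m)\<^sup>2 / (4 * t))" for m r
    using t by (simp add: normal_density_def mult_ac)
  have sq: "sqrt (4 * pi * t) ^ DIM('a) = q"
    using t by (simp add: q_def powr_half_sqrt[symmetric] powr_realpow[symmetric] powr_powr)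
  have prod: "(\<Prod>b\<in>Basis. normal_density (a \<bullet> b) (sqrt (2 * t)) (x \<bullet> b)) = 1 / q * ?e x" for x
  proof -
    have "(\<Sum>b\<in>Basis. - (x \<bullet> b - a \<bullet> b)\<^sup>2 / (4 * t)) = - (norm (x - a))\<^sup>2 / (4 * t)"
      unfolding power2_norm_eq_inner euclidean_inner[of "x - a" "x - a"]
      by (simp add: sum_negf sum_divide_distrib inner_diff_left power2_eq_square)
    then show ?thesis
      unfolding nd prod.distrib prod_constant exp_sum[OF finite_Basis, symmetric]
      by (simp add: power_divide sq)
  qed
  have "(\<integral>\<^sup>+x. (\<Prod>b\<in>Basis. ennreal (normal_density (a \<bullet> b) (sqrt (2 * t)) (x \<bullet> b))) \<partial>lborel)
      = (\<Prod>b\<in>(Basis::'a set). \<integral>\<^sup>+r. ennreal (normal_density (a \<bullet> b) (sqrt (2 * t)) r) \<partial>lborel)"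
    by (rule nn_integral_lborel_prod) auto
  also have "\<dots> = 1"
  proof (rule prod.neutral, rule ballI)
    fix b :: 'a
    interpret prob_space "density lborel (normal_density (a \<bullet> b) (sqrt (2 * t)))"
      using t by (intro prob_space_normal_density) simp
    show "(\<integral>\<^sup>+r. ennreal (normal_density (a \<bullet> b) (sqrt (2 * t)) r) \<partial>lborel) = 1"
      using emeasure_space_1 by (simp add: emeasure_density)
  qed
  finally have one: "(\<integral>\<^sup>+x. ennreal (1 / q * ?e x) \<partial>lborel) = ennreal 1"
    by (simp only: prod_ennreal normal_density_nonneg prod ennreal_1)
  have "has_bochner_integral lborel (\<lambda>x. 1 / q * ?e x) 1"
  proof (rule has_bochner_integral_nn_integral)
    show "AE x in lborel. 0 \<le> 1 / q * ?e x" using q by (intro AE_I2) simp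
  qed (use one in auto)
  then have "has_bochner_integral lborel (\<lambda>x. q * (1 / q * ?e x)) (q * 1)"
    by (rule has_bochner_integral_mult_right)
  then show ?thesis using q by (simp add: q_def)
qed

lemma lborel_integral_affine:
  fixes f :: "'a::euclidean_space \<Rightarrow> real"
  assumes [measurable]: "f \<in> borel_measurable borel" and c: "c \<noteq> 0"
  shows "(\<integral>x. f x \<partial>lborel) = \<bar>c\<bar> ^ DIM('a) * (\<integral>x. f (a + c *\<^sub>R x) \<partial>lborel)"
  by (subst lborel_affine[OF c, of a])
    (simp add: integral_density integral_distr)

text \<open>
  The substitution \<open>x = y + \<surd>t z\<close> moves \<open>t\<close> from the kernel into the argument of \<open>\<phi>\<close>; the limit \<open>t \<longrightarrow> 0\<close>
  then only uses continuity of \<open>\<phi>\<close>.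
\<close>

lemma heat_semigroup_affine:
  fixes \<phi> :: "'a::euclidean_space \<Rightarrow> real"
  assumes \<phi>: "\<phi> \<in> Cc" and t: "0 < t"
  shows "heat_semigroup t \<phi> y = 1 / (4 * pi) powr (real DIM('a) / 2)
    * (\<integral>z. exp (- (norm z)\<^sup>2 / 4) * \<phi> (y + sqrt t *\<^sub>R z) \<partial>lborel)"
proof -
  have [measurable]: "\<phi> \<in> borel_measurable borel" by (rule Cc_borel_measurable[OF \<phi>])
  have "(\<integral>x. exp (- (norm (y - x))\<^sup>2 / (4 * t)) * \<phi> x \<partial>lborel) = \<bar>sqrt t\<bar> ^ DIM('a) *
      (\<integral>z. exp (- (norm (y - (y + sqrt t *\<^sub>R z)))\<^sup>2 / (4 * t)) * \<phi> (y + sqrt t *\<^sub>R z) \<partial>lborel)"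
    using t by (intro lborel_integral_affine) auto
  also have "\<bar>sqrt t\<bar> ^ DIM('a) = t powr (real DIM('a) / 2)"
    using t by (simp add: powr_half_sqrt[symmetric] powr_realpow[symmetric] powr_powr)
  also have "(\<integral>z. exp (- (norm (y - (y + sqrt t *\<^sub>R z)))\<^sup>2 / (4 * t)) * \<phi> (y + sqrt t *\<^sub>R z) \<partial>lborel)
      = (\<integral>z. exp (- (norm z)\<^sup>2 / 4) * \<phi> (y + sqrt t *\<^sub>R z) \<partial>lborel)"
    using t by (intro Bochner_Integration.integral_cong) (auto simp: power_mult_distrib)
  finally show ?thesis
    using t by (simp add: heat_semigroup_def powr_mult)
qed

lemma heat_semigroup_tendsto:
  fixes \<phi> :: "'a::euclidean_space \<Rightarrow> real"
  assumes \<phi>: "\<phi> \<in> Cc" and S: "\<And>n. 0 < S n" "S \<longlonglongrightarrow> 0"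
  shows "(\<lambda>n. heat_semigroup (S n) \<phi> y) \<longlonglongrightarrow> \<phi> y"
proof -
  have m[measurable]: "\<phi> \<in> borel_measurable borel" by (rule Cc_borel_measurable[OF \<phi>])
  obtain R B where RB: "0 \<le> R" "0 \<le> B" "\<And>x. \<bar>\<phi> x\<bar> \<le> B * indicator (cball 0 R) x"
    using Cc_bounded_support[OF \<phi>] by blast
  have B: "\<bar>\<phi> x\<bar> \<le> B" for x
    using RB(3)[of x] RB(2) by (cases "norm x \<le> R") auto
  have gauss: "has_bochner_integral lborel (\<lambda>z::'a. exp (- (norm z)\<^sup>2 / 4)) ((4 * pi) powr (real DIM('a) / 2))"
    using has_bochner_integral_gaussian[of 1 "0::'a"] by simp
  have "(\<lambda>n. \<integral>z. exp (- (norm z)\<^sup>2 / 4) * \<phi> (y + sqrt (S n) *\<^sub>R z) \<partial>lborel)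
      \<longlonglongrightarrow> integral\<^sup>L lborel (\<lambda>z::'a. exp (- (norm z)\<^sup>2 / 4) * \<phi> y)"
  proof (rule integral_dominated_convergence[where w="\<lambda>z::'a. exp (- (norm z)\<^sup>2 / 4) * B"])
    show "integrable lborel (\<lambda>z::'a. exp (- (norm z)\<^sup>2 / 4) * B)"
      using gauss by (auto intro: integrable_mult_left simp: has_bochner_integral_iff)
    have cont: "isCont \<phi> y" using \<phi> by (auto simp: Cc_def continuous_on_eq_continuous_at)
    have "(\<lambda>n. \<phi> (y + sqrt (S n) *\<^sub>R z)) \<longlonglongrightarrow> \<phi> y" for z
    proof (rule isCont_tendsto_compose[OF cont])
      have "(\<lambda>n. y + sqrt (S n) *\<^sub>R z) \<longlonglongrightarrow> y + sqrt 0 *\<^sub>R z"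
        by (intro tendsto_intros S)
      then show "(\<lambda>n. y + sqrt (S n) *\<^sub>R z) \<longlonglongrightarrow> y" by simp
    qed
    then show "AE z in lborel. (\<lambda>n. exp (- (norm z)\<^sup>2 / 4) * \<phi> (y + sqrt (S n) *\<^sub>R z)) \<longlonglongrightarrow> exp (- (norm z)\<^sup>2 / 4) * \<phi> y"
      by (intro AE_I2 tendsto_mult_left)
    show "AE z in lborel. norm (exp (- (norm z)\<^sup>2 / 4) * \<phi> (y + sqrt (S n) *\<^sub>R z)) \<le> exp (- (norm z)\<^sup>2 / 4) * B" for n
      using B by (intro AE_I2) (simp add: abs_mult)
  qed auto
  also have "integral\<^sup>L lborel (\<lambda>z::'a. exp (- (norm z)\<^sup>2 / 4) * \<phi> y) = (4 * pi) powr (real DIM('a) / 2) * \<phi> y"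
    using gauss by (simp add: has_bochner_integral_iff)
  finally have lim: "(\<lambda>n. 1 / (4 * pi) powr (real DIM('a) / 2) *
      (\<integral>z. exp (- (norm z)\<^sup>2 / 4) * \<phi> (y + sqrt (S n) *\<^sub>R z) \<partial>lborel))
    \<longlonglongrightarrow> 1 / (4 * pi) powr (real DIM('a) / 2) * ((4 * pi) powr (real DIM('a) / 2) * \<phi> y)"
    by (rule tendsto_mult_left)
  then show ?thesis
    by (simp add: heat_semigroup_affine[OF \<phi> S(1)])
qed

text \<open>
  Splitting the kernel into two equal halves, one half (with \<open>1/8t \<ge> 2\<epsilon>\<close>) pays for the decay in
  \<open>y\<close>, and the other still has integral \<open>2\<^bsup>d/2\<^esup>\<close> against the prefactor; this makes the bound
  independent of \<open>t\<close>.
\<close>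

lemma heat_semigroup_gaussian_bound:
  fixes \<phi> :: "'a::euclidean_space \<Rightarrow> real"
  assumes RB: "0 \<le> B" "\<And>x. \<bar>\<phi> x\<bar> \<le> B * indicator (cball 0 R) x" and m[measurable]: "\<phi> \<in> borel_measurable borel"
    and t: "0 < t" "t \<le> 1 / (16 * \<epsilon>)" and \<epsilon>: "0 < \<epsilon>"
  shows "\<bar>heat_semigroup t \<phi> y\<bar>
    \<le> 2 powr (real DIM('a) / 2) * B * exp (2 * \<epsilon> * R\<^sup>2) * exp (- \<epsilon> * (norm y)\<^sup>2)"
proof -
  define D where "D = B * exp (2 * \<epsilon> * R\<^sup>2) * exp (- \<epsilon> * (norm y)\<^sup>2)"
  have D0: "0 \<le> D" using RB by (simp add: D_def)
  let ?d = "real DIM('a) / 2"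
  have gauss: "has_bochner_integral lborel (\<lambda>x. exp (- (norm (x - y))\<^sup>2 / (4 * (2 * t)))) ((4 * pi * (2 * t)) powr ?d)"
    using t by (intro has_bochner_integral_gaussian) simp
  have pt: "\<bar>exp (- (norm (y - x))\<^sup>2 / (4 * t)) * \<phi> x\<bar> \<le> D * exp (- (norm (x - y))\<^sup>2 / (4 * (2 * t)))" for x
  proof (cases "x \<in> cball 0 R")
    case False
    then have "\<phi> x = 0" using RB(2)[of x] by simp
    then show ?thesis using D0 by simp
  next
    case True
    have "2 * \<epsilon> \<le> 1 / (8 * t)" using t \<epsilon> by (simp add: field_simps)
    then have "2 * \<epsilon> * (norm (x - y))\<^sup>2 \<le> 1 / (8 * t) * (norm (x - y))\<^sup>2"
      by (rule mult_right_mono) simp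
    then have "exp (- (norm (x - y))\<^sup>2 / (8 * t)) \<le> exp (- (2 * \<epsilon>) * (norm (x - y))\<^sup>2)"
      by simp
    also have "\<dots> \<le> exp (\<epsilon> * (2 * \<epsilon>) / (2 * \<epsilon> - \<epsilon>) * (norm x)\<^sup>2) * exp (- \<epsilon> * (norm y)\<^sup>2)"
      using \<epsilon> by (intro gaussian_shift_bound) simp
    also have "\<epsilon> * (2 * \<epsilon>) / (2 * \<epsilon> - \<epsilon>) = 2 * \<epsilon>" using \<epsilon> by simp
    also have "exp (2 * \<epsilon> * (norm x)\<^sup>2) * exp (- \<epsilon> * (norm y)\<^sup>2) \<le> exp (2 * \<epsilon> * R\<^sup>2) * exp (- \<epsilon> * (norm y)\<^sup>2)"
    proof (rule mult_right_mono)
      have "(norm x)\<^sup>2 \<le> R\<^sup>2" using True by (intro power_mono) auto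
      then show "exp (2 * \<epsilon> * (norm x)\<^sup>2) \<le> exp (2 * \<epsilon> * R\<^sup>2)" using \<epsilon> by simp
    qed simp
    finally have half: "exp (- (norm (x - y))\<^sup>2 / (8 * t)) \<le> exp (2 * \<epsilon> * R\<^sup>2) * exp (- \<epsilon> * (norm y)\<^sup>2)" .
    have "exp (- (norm (y - x))\<^sup>2 / (4 * t)) = exp (- (norm (x - y))\<^sup>2 / (8 * t)) * exp (- (norm (x - y))\<^sup>2 / (8 * t))"
      unfolding exp_add[symmetric] by (simp add: norm_minus_commute)
    then have "\<bar>exp (- (norm (y - x))\<^sup>2 / (4 * t)) * \<phi> x\<bar>
        = \<bar>\<phi> x\<bar> * exp (- (norm (x - y))\<^sup>2 / (8 * t)) * exp (- (norm (x - y))\<^sup>2 / (8 * t))"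
      by (simp add: abs_mult)
    also have "\<dots> \<le> B * (exp (2 * \<epsilon> * R\<^sup>2) * exp (- \<epsilon> * (norm y)\<^sup>2)) * exp (- (norm (x - y))\<^sup>2 / (8 * t))"
      using RB(1) RB(2)[of x] True half by (intro mult_right_mono mult_mono) auto
    finally show ?thesis by (simp add: D_def mult.assoc)
  qed
  have i2: "integrable lborel (\<lambda>x. D * exp (- (norm (x - y))\<^sup>2 / (4 * (2 * t))))"
    using gauss by (auto simp: has_bochner_integral_iff intro: integrable_mult_right)
  have i1: "integrable lborel (\<lambda>x. exp (- (norm (y - x))\<^sup>2 / (4 * t)) * \<phi> x)"
  proof (rule Bochner_Integration.integrable_bound[OF i2])
    show "AE x in lborel. norm (exp (- (norm (y - x))\<^sup>2 / (4 * t)) * \<phi> x)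
        \<le> norm (D * exp (- (norm (x - y))\<^sup>2 / (4 * (2 * t))))"
      unfolding real_norm_def by (rule AE_I2) (rule order_trans[OF pt abs_ge_self])
  qed measurable
  have "\<bar>\<integral>x. exp (- (norm (y - x))\<^sup>2 / (4 * t)) * \<phi> x \<partial>lborel\<bar>
      \<le> (\<integral>x. \<bar>exp (- (norm (y - x))\<^sup>2 / (4 * t)) * \<phi> x\<bar> \<partial>lborel)"
    by (rule integral_abs_bound)
  also have "\<dots> \<le> (\<integral>x. D * exp (- (norm (x - y))\<^sup>2 / (4 * (2 * t))) \<partial>lborel)"
    by (rule integral_mono[OF integrable_abs[OF i1] i2 pt])
  also have "\<dots> = D * (4 * pi * (2 * t)) powr ?d"
    using gauss by (simp add: has_bochner_integral_iff)
  finally have b: "\<bar>\<integral>x. exp (- (norm (y - x))\<^sup>2 / (4 * t)) * \<phi> x \<partial>lborel\<bar> \<le> D * (4 * pi * (2 * t)) powr ?d" .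
  have "\<bar>heat_semigroup t \<phi> y\<bar> = 1 / (4 * pi * t) powr ?d * \<bar>\<integral>x. exp (- (norm (y - x))\<^sup>2 / (4 * t)) * \<phi> x \<partial>lborel\<bar>"
    using t by (simp add: heat_semigroup_def abs_mult)
  also have "\<dots> \<le> 1 / (4 * pi * t) powr ?d * (D * (4 * pi * (2 * t)) powr ?d)"
    using b by (rule mult_left_mono) simp
  also have "\<dots> = 2 powr ?d * D"
  proof -
    have "(4 * pi * (2 * t)) powr ?d = 2 powr ?d * (4 * pi * t) powr ?d"
      using t by (simp add: powr_mult[symmetric] mult_ac)
    then show ?thesis using t by simp
  qed
  finally show ?thesis by (simp add: D_def mult.assoc)
qed

context gaussian_growth
begin

text \<open>
  The function \<open>\<phi>\<close> confines \<open>x\<close> to a ball, on which the kernel is dominated by a fixed multiple of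
  \<open>exp (- \<epsilon>|y|\<^sup>2)\<close>; a product of two integrable functions remains.
\<close>

lemma kernel_product_integrable:
  assumes \<phi>: "\<phi> \<in> Cc" and t: "0 < t" "t < 1 / (4 * \<epsilon>)"
  shows "integrable (lborel \<Otimes>\<^sub>M M) (\<lambda>(x, y). \<phi> x * exp (- (norm (x - y))\<^sup>2 / (4 * t)))"
proof -
  interpret sigma_finite_measure M by (rule radon_measure_sigma_finite[OF radon])
  interpret pair_sigma_finite lborel M ..
  have [measurable]: "\<phi> \<in> borel_measurable borel" by (rule Cc_borel_measurable[OF \<phi>])
  obtain R B where RB: "0 \<le> R" "0 \<le> B" "\<And>x. \<bar>\<phi> x\<bar> \<le> B * indicator (cball 0 R) x"
    using Cc_bounded_support[OF \<phi>] by blast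
  define s where "s = 1 / (4 * t)"
  have s: "\<epsilon> < s" using t \<epsilon>_pos by (simp add: s_def field_simps)
  define C where "C = B * exp (\<epsilon> * s / (s - \<epsilon>) * R\<^sup>2)"
  have C: "0 \<le> C" using RB by (simp add: C_def)
  define a :: "'a \<Rightarrow> real" where "a x = C * indicator (cball 0 R) x" for x
  define b :: "'a \<Rightarrow> real" where "b y = exp (- \<epsilon> * (norm y)\<^sup>2)" for y
  have a: "integrable lborel a"
    unfolding a_def
    by (intro integrable_mult_right integrable_real_indicator)
      (use emeasure_bounded_finite[OF bounded_cball[of "0::'a" R]] in simp_all)
  have b: "integrable M b" unfolding b_def by (rule integrable_gaussian)
  have [measurable]: "a \<in> borel_measurable borel"
    unfolding a_def[abs_def] by (intro borel_measurable_times borel_measurable_indicator) auto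
  have [measurable]: "b \<in> borel_measurable borel"
    unfolding b_def[abs_def] by (intro borel_measurable_continuous_onI continuous_intros)
  have ab: "0 \<le> a x" "0 \<le> b x" for x using C by (auto simp: a_def b_def)
  let ?D = "\<lambda>(x, y). a x * b y"
  have "integrable (lborel \<Otimes>\<^sub>M M) ?D"
  proof (rule Fubini_integrable)
    show "integrable lborel (\<lambda>x. \<integral>y. norm (?D (x, y)) \<partial>M)"
      using a ab by simp
    show "AE x in lborel. integrable M (\<lambda>y. ?D (x, y))"
      by (intro AE_I2) (use b in simp)
  qed measurable
  then show ?thesis
  proof (rule Bochner_Integration.integrable_bound)
    show "AE p in lborel \<Otimes>\<^sub>M M. norm (case p of (x, y) \<Rightarrow> \<phi> x * exp (- (norm (x - y))\<^sup>2 / (4 * t))) \<le> norm (?D p)"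
    proof (rule AE_I2, clarify)
      fix x y :: 'a
      show "norm (\<phi> x * exp (- (norm (x - y))\<^sup>2 / (4 * t))) \<le> norm (a x * b y)"
      proof (cases "x \<in> cball 0 R")
        case False
        then have "\<phi> x = 0" using RB(3)[of x] by simp
        then show ?thesis by simp
      next
        case True
        have "exp (- (norm (x - y))\<^sup>2 / (4 * t)) = exp (- s * (norm (x - y))\<^sup>2)" by (simp add: s_def)
        also have "\<dots> \<le> exp (\<epsilon> * s / (s - \<epsilon>) * (norm x)\<^sup>2) * exp (- \<epsilon> * (norm y)\<^sup>2)"
          by (rule gaussian_shift_bound[OF s])
        also have "\<dots> \<le> exp (\<epsilon> * s / (s - \<epsilon>) * R\<^sup>2) * exp (- \<epsilon> * (norm y)\<^sup>2)"
        proof (rule mult_right_mono)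
          have "(norm x)\<^sup>2 \<le> R\<^sup>2" using True by (intro power_mono) auto
          then have "\<epsilon> * s / (s - \<epsilon>) * (norm x)\<^sup>2 \<le> \<epsilon> * s / (s - \<epsilon>) * R\<^sup>2"
            by (rule mult_left_mono) (use s \<epsilon>_pos in auto)
          then show "exp (\<epsilon> * s / (s - \<epsilon>) * (norm x)\<^sup>2) \<le> exp (\<epsilon> * s / (s - \<epsilon>) * R\<^sup>2)"
            by (simp only: exp_le_cancel_iff)
        qed simp
        finally have "\<bar>\<phi> x\<bar> * exp (- (norm (x - y))\<^sup>2 / (4 * t))
            \<le> B * (exp (\<epsilon> * s / (s - \<epsilon>) * R\<^sup>2) * exp (- \<epsilon> * (norm y)\<^sup>2))"
          using RB(2) RB(3)[of x] True by (intro mult_mono) auto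
        then show ?thesis using True RB(2) by (simp add: a_def b_def C_def abs_mult mult.assoc)
      qed
    qed
  qed measurable
qed

proposition potential_duality:
  assumes \<phi>: "\<phi> \<in> Cc" and t: "0 < t" "t < 1 / (4 * \<epsilon>)"
  shows "integrable M (heat_semigroup t \<phi>)"
    and "integrable lborel (\<lambda>x. \<phi> x * potential x t)"
    and "(\<integral>x. \<phi> x * potential x t \<partial>lborel) = (\<integral>y. h y * heat_semigroup t \<phi> y \<partial>M)"
proof -
  interpret sigma_finite_measure M by (rule radon_measure_sigma_finite[OF radon])
  interpret pair_sigma_finite lborel M ..
  have [measurable]: "\<phi> \<in> borel_measurable borel" by (rule Cc_borel_measurable[OF \<phi>])
  let ?k = "\<lambda>x y. exp (- (norm (x - y))\<^sup>2 / (4 * t))"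
  let ?c = "1 / (4 * pi * t) powr (real DIM('a) / 2)"
  have K: "integrable (lborel \<Otimes>\<^sub>M M) (\<lambda>(x, y). \<phi> x * ?k x y)"
    by (rule kernel_product_integrable[OF \<phi> t])
  have hK: "integrable (lborel \<Otimes>\<^sub>M M) (\<lambda>(x, y). \<phi> x * (h y * ?k x y))"
    by (rule Bochner_Integration.integrable_bound[OF K]) (auto simp: abs_mult abs_h)
  have S: "heat_semigroup t \<phi> y = ?c * (\<integral>x. \<phi> x * ?k x y \<partial>lborel)" for y
    using t by (simp add: heat_semigroup_def norm_minus_commute mult.commute)
  show "integrable M (heat_semigroup t \<phi>)"
    unfolding S[abs_def] by (rule integrable_mult_right[OF integrable_snd[OF K]])
  have P: "\<phi> x * potential x t = ?c * (\<integral>y. \<phi> x * (h y * ?k x y) \<partial>M)" for x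
    unfolding potential_def integral_mult_right_zero by (rule mult.left_commute)
  show "integrable lborel (\<lambda>x. \<phi> x * potential x t)"
    unfolding P by (rule integrable_mult_right[OF integrable_fst[OF hK]])
  have "(\<integral>x. \<phi> x * potential x t \<partial>lborel) = ?c * (\<integral>x. \<integral>y. \<phi> x * (h y * ?k x y) \<partial>M \<partial>lborel)"
    unfolding P by (rule integral_mult_right_zero)
  also have "(\<integral>x. \<integral>y. \<phi> x * (h y * ?k x y) \<partial>M \<partial>lborel) = (\<integral>y. \<integral>x. \<phi> x * (h y * ?k x y) \<partial>lborel \<partial>M)"
    by (rule Fubini_integral[OF hK, symmetric])
  also have "?c * \<dots> = (\<integral>y. ?c * (\<integral>x. \<phi> x * (h y * ?k x y) \<partial>lborel) \<partial>M)"
    by (rule integral_mult_right_zero[symmetric])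
  also have "\<dots> = (\<integral>y. h y * heat_semigroup t \<phi> y \<partial>M)"
    unfolding S mult.left_commute[of "\<phi> _" "h _"] integral_mult_right_zero
    by (simp only: mult.left_commute[of "h _" ?c] integral_mult_right_zero)
  finally show "(\<integral>x. \<phi> x * potential x t \<partial>lborel) = (\<integral>y. h y * heat_semigroup t \<phi> y \<partial>M)" .
qed

proposition potential_initial_value:
  assumes \<phi>: "\<phi> \<in> Cc"
  shows "((\<lambda>t. \<integral>x. \<phi> x * potential x t \<partial>lborel) \<longlongrightarrow> (\<integral>y. h y * \<phi> y \<partial>M)) (at_right 0)"
proof (rule tendsto_at_right_sequentially)
  \<comment> \<open>The uniform bound on \<open>S(t)\<phi>\<close> holds up to time \<open>1/16\<epsilon>\<close>.\<close>
  show "0 < 1 / (16 * \<epsilon>)" using \<epsilon>_pos by simp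
  fix S :: "nat \<Rightarrow> real"
  assume S: "\<And>n. 0 < S n" "\<And>n. S n < 1 / (16 * \<epsilon>)" "S \<longlonglongrightarrow> 0"
  have m[measurable]: "\<phi> \<in> borel_measurable borel" by (rule Cc_borel_measurable[OF \<phi>])
  obtain R B where RB: "0 \<le> R" "0 \<le> B" "\<And>x. \<bar>\<phi> x\<bar> \<le> B * indicator (cball 0 R) x"
    using Cc_bounded_support[OF \<phi>] by blast
  have S4: "S n < 1 / (4 * \<epsilon>)" for n
  proof -
    have "1 / (16 * \<epsilon>) \<le> 1 / (4 * \<epsilon>)" using \<epsilon>_pos by (simp add: field_simps)
    with S(2)[of n] show ?thesis by linarith
  qed
  let ?w = "\<lambda>y. 2 powr (real DIM('a) / 2) * B * exp (2 * \<epsilon> * R\<^sup>2) * exp (- \<epsilon> * (norm y)\<^sup>2)"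
  have "(\<lambda>n. \<integral>y. h y * heat_semigroup (S n) \<phi> y \<partial>M) \<longlonglongrightarrow> (\<integral>y. h y * \<phi> y \<partial>M)"
  proof (rule integral_dominated_convergence[where w="?w"])
    show "integrable M ?w" by (rule integrable_mult_right[OF integrable_gaussian])
    show "(\<lambda>y. h y * heat_semigroup (S n) \<phi> y) \<in> borel_measurable M" for n
      using integrable_h[OF potential_duality(1)[OF \<phi> S(1) S4]] by blast
    show "AE y in M. (\<lambda>n. h y * heat_semigroup (S n) \<phi> y) \<longlonglongrightarrow> h y * \<phi> y"
      by (intro AE_I2 tendsto_mult_left heat_semigroup_tendsto[OF \<phi>] S)
    show "AE y in M. norm (h y * heat_semigroup (S n) \<phi> y) \<le> ?w y" for n
      using heat_semigroup_gaussian_bound[OF RB(2,3) m S(1) less_imp_le[OF S(2)] \<epsilon>_pos]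
      by (intro AE_I2) (simp add: abs_mult abs_h)
  qed auto
  then show "(\<lambda>n. \<integral>x. \<phi> x * potential x (S n) \<partial>lborel) \<longlonglongrightarrow> (\<integral>y. h y * \<phi> y \<partial>M)"
    by (simp add: potential_duality(3)[OF \<phi> S(1) S4])
qed

lemma potential_pos:
  assumes h1: "AE y in M. h y = 1" and nz: "emeasure M UNIV \<noteq> 0" and t: "0 < t" "t < 1 / (4 * \<epsilon>)"
  shows "0 < potential x t"
proof -
  let ?k = "\<lambda>y. exp (- (norm (x - y))\<^sup>2 / (4 * t))"
  have "\<epsilon> < 1 / (4 * t)" using t \<epsilon>_pos by (simp add: field_simps)
  then have k: "integrable M ?k" using integrable_kernel[of "1 / (4 * t)" x] by simp
  have sp: "space M = UNIV" using sets_eq_imp_space_eq[OF sets_M] by simp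
  have "(\<integral>y. ?k y \<partial>M) \<noteq> 0"
  proof
    assume "(\<integral>y. ?k y \<partial>M) = 0"
    then have "AE y in M. ?k y = 0"
      using integral_nonneg_eq_0_iff_AE[OF k] by simp
    then have "AE y in M. False" by simp
    then show False using nz sp by (auto simp: AE_iff_measurable[OF _ refl])
  qed
  moreover have "0 \<le> (\<integral>y. ?k y \<partial>M)" by (rule Bochner_Integration.integral_nonneg) simp
  moreover have "(\<integral>y. h y * ?k y \<partial>M) = (\<integral>y. ?k y \<partial>M)"
    using h1 by (intro integral_cong_AE) auto
  ultimately have "0 < (\<integral>y. h y * ?k y \<partial>M)" by linarith
  then show ?thesis using t by (simp add: potential_def)
qed

end

lemma Linf_loc_continuous:
  assumes "continuous_on UNIV f"
  shows "Linf_loc f"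
  unfolding Linf_loc_def
proof (intro conjI allI impI)
  show "f \<in> borel_measurable lebesgue"
    using borel_measurable_continuous_onI[OF assms] by (intro measurable_completion) simp
  fix K :: "'a set" assume K: "compact K"
  then have "bounded (f ` K)"
    using continuous_on_subset[OF assms] by (intro compact_imp_bounded compact_continuous_image) auto
  then obtain C where "\<forall>x\<in>K. \<bar>f x\<bar> \<le> C" by (auto simp: bounded_iff)
  then show "\<exists>C. AE x in lebesgue. x \<in> K \<longrightarrow> \<bar>f x\<bar> \<le> C"
    by (intro exI[of _ C] AE_I2) blast
qed

section \<open>The heat equation with measure data\<close>

theorem theorem3p6:
  fixes \<epsilon> T :: real
    and u0 :: "('a::euclidean_space) radon"
    and u :: "'a \<Rightarrow> real \<Rightarrow> real"
  assumes "\<epsilon> > 0"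
    and "u0 \<in> M_eps \<epsilon>"
    and "T = 1 / (4 * \<epsilon>)"
    and "u = heat_solution u0"
  shows
    \<comment> \<open>the integral defining \<open>u\<close> converges absolutely\<close>
    "(\<forall>x. \<forall>t\<in>{0<..<T}. radon_integrable u0 (\<lambda>y. exp (- (norm (x - y))\<^sup>2 / (4 * t)))) \<and>
     \<comment> \<open>(i)\<close>
     (\<forall>t\<in>{0<..<T}. Linf_loc (\<lambda>x. u x t)) \<and>
     Cinf_on (\<lambda>(x, t). u x t) (UNIV \<times> {0<..<T}) \<and>
     (\<forall>x. \<forall>t\<in>{0<..<T}. deriv (\<lambda>s. u x s) t - laplacian (\<lambda>y. u y t) x = 0) \<and>
     \<comment> \<open>(ii)\<close>
     (\<forall>\<phi>\<in>Cc. \<forall>t\<in>{0..<T}.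
        radon_integrable u0 (heat_semigroup t \<phi>) \<and>
        (t > 0 \<longrightarrow> integrable lborel (\<lambda>x. \<phi> x * u x t)) \<and>
        (if t = 0 then radon_integral u0 \<phi> else (\<integral>x. \<phi> x * u x t \<partial>lborel))
          = radon_integral u0 (heat_semigroup t \<phi>)) \<and>
     (\<forall>\<phi>\<in>Cc. ((\<lambda>t. \<integral>x. \<phi> x * u x t \<partial>lborel) \<longlongrightarrow> radon_integral u0 \<phi>) (at_right 0)) \<and>
     \<comment> \<open>(iii)\<close>
     (radon_nonneg u0 \<and> radon_nonzero u0 \<longrightarrow> (\<forall>x. \<forall>t\<in>{0<..<T}. u x t > 0))"
proof -
  have \<epsilon>: "0 < \<epsilon>" and T: "T = 1 / (4 * \<epsilon>)" using assms by auto
  obtain M h where M: "radon_measure M" and h: "h \<in> borel_measurable borel" "\<And>y. \<bar>h y\<bar> = 1"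
    and int: "integrable M (\<lambda>y. exp (- \<epsilon> * (norm y)\<^sup>2))"
    and integrable_u0: "\<And>f. integrable M f \<Longrightarrow> radon_integrable u0 f"
    and integral_u0: "\<And>f. integrable M f \<Longrightarrow> radon_integral u0 f = (\<integral>y. h y * f y \<partial>M)"
    and nonneg: "radon_nonneg u0 \<Longrightarrow> AE y in M. h y = 1"
    and nonzero: "radon_nonzero u0 \<Longrightarrow> emeasure M UNIV \<noteq> 0"
    by (rule M_eps_polar[OF assms(2)]) (rule that; assumption)
  \<comment> \<open>The heat kernel is integrated against \<open>h M\<close>, so \<open>u\<close> is the potential of \<open>h M\<close> as long as \<open>1/4t > \<epsilon>\<close>.\<close>
  interpret gaussian_growth M h \<epsilon>
    using M h int \<epsilon> by unfold_locales auto
  have kernel: "integrable M (\<lambda>y. exp (- (norm (x - y))\<^sup>2 / (4 * t)))" if t: "0 < t" "t < T" for x t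
  proof -
    have "\<epsilon> < 1 / (4 * t)" using t T \<epsilon> by (simp add: field_simps)
    then show ?thesis using integrable_kernel[of "1 / (4 * t)" x] by simp
  qed
  have u: "u x t = potential x t" if "0 < t" "t < T" for x t
    unfolding assms(4) heat_solution_def potential_def integral_u0[OF kernel[OF that]] ..
  have S: "open ((UNIV :: 'a set) \<times> {0<..<T})" by (intro open_Times) auto
  have smooth: "Cinf_on (\<lambda>(x, t). u x t) (UNIV \<times> {0<..<T})"
    unfolding Cinf_on_def
  proof
    fix k
    have "Ck_on k (\<lambda>(x, t). potential x t) (UNIV \<times> {0<..<T})"
      using potential_Cinf_on unfolding Cinf_on_def T by blast
    then show "Ck_on k (\<lambda>(x, t). u x t) (UNIV \<times> {0<..<T})"
      by (rule Ck_on_cong[OF S]) (auto simp: u)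
  qed
  have "continuous_on (UNIV \<times> {0<..<T}) (\<lambda>(x, t). u x t)"
    using smooth unfolding Cinf_on_def by (metis Ck_on.simps(1))
  then have cont: "continuous_on UNIV (\<lambda>x. case (x, t) of (x, t) \<Rightarrow> u x t)" if "t \<in> {0<..<T}" for t
    by (rule continuous_on_compose2) (use that in \<open>auto intro!: continuous_intros\<close>)
  have bounded: "\<forall>t\<in>{0<..<T}. Linf_loc (\<lambda>x. u x t)"
    using cont by (auto intro!: Linf_loc_continuous)
  have heat: "deriv (\<lambda>s. u x s) t - laplacian (\<lambda>y. u y t) x = 0" if t: "0 < t" "t < T" for x t
  proof -
    have "eventually (\<lambda>s. s \<in> {0<..<T}) (nhds t)"
      using t by (intro eventually_nhds_in_open) auto
    then have "eventually (\<lambda>s. u x s = potential x s) (nhds t)"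
      by eventually_elim (auto simp: u)
    then have "deriv (\<lambda>s. u x s) t = deriv (\<lambda>s. potential x s) t"
      by (rule deriv_cong_ev) simp
    moreover have "(\<lambda>y. u y t) = (\<lambda>y. potential y t)" using u[OF t] by blast
    ultimately show ?thesis using potential_heat_equation[of t x] t T by simp
  qed
  have duality: "radon_integrable u0 (heat_semigroup t \<phi>) \<and>
      (t > 0 \<longrightarrow> integrable lborel (\<lambda>x. \<phi> x * u x t)) \<and>
      (if t = 0 then radon_integral u0 \<phi> else (\<integral>x. \<phi> x * u x t \<partial>lborel))
        = radon_integral u0 (heat_semigroup t \<phi>)" if \<phi>: "\<phi> \<in> Cc" and t: "0 \<le> t" "t < T" for \<phi> t
  proof (cases "t = 0")
    case True
    have "heat_semigroup t \<phi> = \<phi>" by (simp add: True heat_semigroup_def fun_eq_iff)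
    then show ?thesis using True integrable_u0[OF Cc_integrable[OF M \<phi>]] by simp
  next
    case False
    then have t': "0 < t" "t < 1 / (4 * \<epsilon>)" using t T by auto
    have "u x t = potential x t" for x using u t' T by simp
    then show ?thesis
      using False potential_duality[OF \<phi> t'] integrable_u0 integral_u0 by simp
  qed
  have initial: "((\<lambda>t. \<integral>x. \<phi> x * u x t \<partial>lborel) \<longlongrightarrow> radon_integral u0 \<phi>) (at_right 0)" if \<phi>: "\<phi> \<in> Cc" for \<phi>
  proof -
    have "eventually (\<lambda>t. t \<in> {0<..<T}) (at_right 0)"
      using T \<epsilon> by (intro eventually_at_right_real) simp
    then have "eventually (\<lambda>t. (\<integral>x. \<phi> x * potential x t \<partial>lborel) = (\<integral>x. \<phi> x * u x t \<partial>lborel)) (at_right 0)"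
      by eventually_elim (simp add: u)
    from Lim_transform_eventually[OF potential_initial_value[OF \<phi>] this] show ?thesis
      unfolding integral_u0[OF Cc_integrable[OF M \<phi>]] .
  qed
  have pos: "0 < u x t" if "radon_nonneg u0" "radon_nonzero u0" "0 < t" "t < T" for x t
    using potential_pos[OF nonneg nonzero, of t x] u[of t x] that T by simp
  show ?thesis
  proof (intro conjI)
    show "\<forall>x. \<forall>t\<in>{0<..<T}. radon_integrable u0 (\<lambda>y. exp (- (norm (x - y))\<^sup>2 / (4 * t)))"
      using integrable_u0[OF kernel] by simp
    show "\<forall>x. \<forall>t\<in>{0<..<T}. deriv (\<lambda>s. u x s) t - laplacian (\<lambda>y. u y t) x = 0"
      using heat by simp
    show "\<forall>\<phi>\<in>Cc. ((\<lambda>t. \<integral>x. \<phi> x * u x t \<partial>lborel) \<longlongrightarrow> radon_integral u0 \<phi>) (at_right 0)"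
      using initial by blast
    show "radon_nonneg u0 \<and> radon_nonzero u0 \<longrightarrow> (\<forall>x. \<forall>t\<in>{0<..<T}. u x t > 0)"
      using pos by simp
    show "\<forall>\<phi>\<in>Cc. \<forall>t\<in>{0..<T}.
        radon_integrable u0 (heat_semigroup t \<phi>) \<and>
        (t > 0 \<longrightarrow> integrable lborel (\<lambda>x. \<phi> x * u x t)) \<and>
        (if t = 0 then radon_integral u0 \<phi> else (\<integral>x. \<phi> x * u x t \<partial>lborel))
          = radon_integral u0 (heat_semigroup t \<phi>)"
      using duality by (meson atLeastLessThan_iff)
  qed (fact bounded smooth)+
qed

end
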